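(* Let $d\ge 2$ be an integer, $\nu=d/2-1$, $\eta_0>0$, $\xi>0$, $\eta_1>-2$ and $0<k_c<\infty$. Let the Bessel-Lommel covariance be the radial function of $\mathbf{r}\in\mathbb{R}^d$, $r=\|\mathbf{r}\|$, defined by $$C^{BL}_{xx}(\mathbf{r};\boldsymbol\theta)=\frac{r}{(2\pi r)^{d/2}}\int_0^{k_c}k^{d/2}J_{d/2-1}(kr)\left(c_0+c_1k^2+c_2k^4\right)dk,$$ where $c_0=\frac{1}{\eta_0\xi^d}$, $c_1=\frac{\eta_1\xi^2}{\eta_0\xi^d}$, $c_2=\frac{\xi^4}{\eta_0\xi^d}$ (the value at $r=0$ being the limit $r\to0^+$). Then, with $z=k_c\,r>0$, $$C^{BL}_{xx}(z;\boldsymbol\theta)=\sum_{l=0,1,2}\frac{g_l(\boldsymbol\theta)}{z^{2\nu+2l+1}}\left[(2\nu+2l)\,J_\nu(z)\,S_{\nu+2l,\nu-1}(z)-J_{\nu-1}(z)\,S_{\nu+2l+1,\nu}(z)\right],$$ where $$g_0(\boldsymbol\theta)=\frac{k_c^d}{(2\pi)^{d/2}\eta_0\,\xi^d},\qquad g_1(\boldsymbol\theta)=\eta_1(k_c\xi)^2g_0(\boldsymbol\theta),\qquad g_2(\boldsymbol\theta)=(k_c\xi)^4g_0(\boldsymbol\theta),$$ and the Lommel functions are $$S_{\nu,\nu-1}(z)=z^{\nu-1},\quad S_{\nu+2,\nu-1}(z)=z^{\nu+1}\left(1-\frac{4\nu}{z^2}\right),\quad S_{\nu+4,\nu-1}(z)=z^{\nu+3}\left[1-\frac{8(1+\nu)}{z^2}+\frac{32\nu(1+\nu)}{z^4}\right],$$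 $$S_{\nu+1,\nu}(z)=z^{\nu},\quad S_{\nu+3,\nu}(z)=z^{\nu+2}\left(1-\frac{4(1+\nu)}{z^2}\right),\quad S_{\nu+5,\nu}(z)=z^{\nu+4}\left[1-\frac{8(\nu+2)}{z^2}+\frac{32(\nu+1)(\nu+2)}{z^4}\right].$$ Moreover, for $0<k_c<\infty$ and $\eta_1>-2$, these expressions define non-negative definite, infinitely differentiable radial functions on $\mathbb{R}^d$.
   Context: $J_\nu$ is the Bessel function of the first kind of order $\nu$ (for $\nu=0$, $J_{\nu-1}=J_{-1}=-J_1$). $\boldsymbol\theta=(\eta_0,\eta_1,\xi,k_c)$ is the parameter vector. A function $C:\mathbb{R}^d\to\mathbb{R}$ is non-negative definite if $\sum_{i,j}a_ia_jC(\mathbf{s}_i-\mathbf{s}_j)\ge0$ for all finite sets of points $\mathbf{s}_i\in\mathbb{R}^d$ and real coefficients $a_i$. It is radial if it depends only on $\|\mathbf{r}\|$. *)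

theory Defs
  imports "HOL-Analysis.Analysis"
begin

section \<open>Bessel and Lommel functions\<close>

text \<open>
  The Bessel function of the first kind, for arguments \<open>z \<ge> 0\<close>. Since \<open>rGamma = 1/\<Gamma>\<close> vanishes at
  the poles of \<open>\<Gamma>\<close>, negative integer orders are covered, with \<open>J\<^sub>-\<^sub>n = (-1)\<^sup>n J\<^sub>n\<close>. The case distinction
  is there because \<open>0 powr 0 = 0\<close>; it makes \<open>J\<^sub>0(0) = 1\<close>.
\<close>
definition bessel_J :: "real \<Rightarrow> real \<Rightarrow> real" where
  "bessel_J \<nu> z = (if \<nu> = 0 then 1 else (z / 2) powr \<nu>) *
     (\<Sum>m. (-1) ^ m * rGamma (\<nu> + real m + 1) / fact m * (z / 2) ^ (2 * m))"

text \<open>The Lommel function \<open>s\<^sub>\<mu>\<^sub>,\<^sub>\<nu>(z)\<close>, for \<open>z > 0\<close> and \<open>\<mu> \<plusminus> \<nu>\<close> not a negative odd integer.\<close>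
definition lommel_s :: "real \<Rightarrow> real \<Rightarrow> real \<Rightarrow> real" where
  "lommel_s \<mu> \<nu> z = z powr (\<mu> + 1) *
     (\<Sum>k. (-1) ^ k * z ^ (2 * k) / (\<Prod>j\<le>k. (\<mu> + 1 + 2 * real j)\<^sup>2 - \<nu>\<^sup>2))"

text \<open>
  The Lommel function \<open>S\<^sub>\<mu>\<^sub>,\<^sub>\<nu>(z)\<close> for non-integer \<open>\<nu>\<close> and \<open>\<mu> \<plusminus> \<nu>\<close> not a negative odd integer. This is the
  usual
  \<open>s\<^sub>\<mu>\<^sub>,\<^sub>\<nu> + 2\<^sup>\<mu>\<^sup>-\<^sup>1 \<Gamma>((\<mu>+\<nu>+1)/2) \<Gamma>((\<mu>-\<nu>+1)/2) (sin((\<mu>-\<nu>)\<pi>/2) J\<^sub>\<nu> - cos((\<mu>-\<nu>)\<pi>/2) Y\<^sub>\<nu>)\<close>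
  with \<open>Y\<^sub>\<nu> = (J\<^sub>\<nu> cos(\<nu>\<pi>) - J\<^sub>-\<^sub>\<nu>) / sin(\<nu>\<pi>)\<close> inserted.
\<close>
definition lommel_S_generic :: "real \<Rightarrow> real \<Rightarrow> real \<Rightarrow> real" where
  "lommel_S_generic \<mu> \<nu> z = lommel_s \<mu> \<nu> z +
     2 powr (\<mu> - 1) * Gamma ((\<mu> + \<nu> + 1) / 2) * Gamma ((\<mu> - \<nu> + 1) / 2) / sin (\<nu> * pi) *
     (cos ((\<mu> - \<nu>) * pi / 2) * bessel_J (- \<nu>) z - cos ((\<mu> + \<nu>) * pi / 2) * bessel_J \<nu> z)"

text \<open>
  The remaining parameter values are removable singularities and are filled in by continuity, as usual.
  Moving both parameters along the diagonal keeps \<open>\<mu> - \<nu>\<close> fixed; this covers all \<open>\<mu>\<close>, \<open>\<nu>\<close> for which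
  \<open>\<mu> - \<nu>\<close> is not a negative odd integer, in particular \<open>S\<^sub>0\<^sub>,\<^sub>-\<^sub>1\<close>, where \<open>s\<^sub>0\<^sub>,\<^sub>-\<^sub>1\<close> does not exist.
\<close>
definition lommel_S :: "real \<Rightarrow> real \<Rightarrow> real \<Rightarrow> real" where
  "lommel_S \<mu> \<nu> z = Lim (at 0) (\<lambda>\<epsilon>. lommel_S_generic (\<mu> + \<epsilon>) (\<nu> + \<epsilon>) z)"


section \<open>The Bessel-Lommel covariance\<close>

definition bl_profile :: "nat \<Rightarrow> real \<Rightarrow> real \<Rightarrow> real \<Rightarrow> real \<Rightarrow> real \<Rightarrow> real" where
  "bl_profile d \<eta>\<^sub>0 \<eta>\<^sub>1 \<xi> k\<^sub>c r =
     (let c\<^sub>0 = 1 / (\<eta>\<^sub>0 * \<xi> ^ d);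
          c\<^sub>1 = \<eta>\<^sub>1 * \<xi>\<^sup>2 / (\<eta>\<^sub>0 * \<xi> ^ d);
          c\<^sub>2 = \<xi> ^ 4 / (\<eta>\<^sub>0 * \<xi> ^ d)
      in r / (2 * pi * r) powr (real d / 2) *
         integral {0..k\<^sub>c} (\<lambda>k. k powr (real d / 2) * bessel_J (real d / 2 - 1) (k * r) *
           (c\<^sub>0 + c\<^sub>1 * k\<^sup>2 + c\<^sub>2 * k ^ 4)))"

definition bl_cov :: "real \<Rightarrow> real \<Rightarrow> real \<Rightarrow> real \<Rightarrow> real ^ 'n \<Rightarrow> real" where
  "bl_cov \<eta>\<^sub>0 \<eta>\<^sub>1 \<xi> k\<^sub>c x =
     (if x = 0 then Lim (at_right 0) (bl_profile CARD('n) \<eta>\<^sub>0 \<eta>\<^sub>1 \<xi> k\<^sub>c)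
      else bl_profile CARD('n) \<eta>\<^sub>0 \<eta>\<^sub>1 \<xi> k\<^sub>c (norm x))"

definition bl_g :: "nat \<Rightarrow> real \<Rightarrow> real \<Rightarrow> real \<Rightarrow> real \<Rightarrow> nat \<Rightarrow> real" where
  "bl_g d \<eta>\<^sub>0 \<eta>\<^sub>1 \<xi> k\<^sub>c l =
     (let g\<^sub>0 = k\<^sub>c ^ d / ((2 * pi) powr (real d / 2) * \<eta>\<^sub>0 * \<xi> ^ d)
      in if l = 0 then g\<^sub>0
         else if l = 1 then \<eta>\<^sub>1 * (k\<^sub>c * \<xi>)\<^sup>2 * g\<^sub>0
         else (k\<^sub>c * \<xi>) ^ 4 * g\<^sub>0)"


section \<open>Properties of functions\<close>

definition radial :: "('a::real_normed_vector \<Rightarrow> 'b) \<Rightarrow> bool" where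
  "radial f \<longleftrightarrow> (\<forall>x y. norm x = norm y \<longrightarrow> f x = f y)"

definition nonneg_definite :: "('a::ab_group_add \<Rightarrow> real) \<Rightarrow> bool" where
  "nonneg_definite f \<longleftrightarrow>
     (\<forall>S a. finite S \<longrightarrow> (\<Sum>x\<in>S. \<Sum>y\<in>S. a x * a y * f (x - y)) \<ge> 0)"

text \<open>\<open>n\<close> times continuously differentiable on the whole space.\<close>
primrec times_cont_diff ::
    "nat \<Rightarrow> ('a::real_normed_vector \<Rightarrow> 'b::real_normed_vector) \<Rightarrow> bool" where
  "times_cont_diff 0 f \<longleftrightarrow> continuous_on UNIV f"
| "times_cont_diff (Suc n) f \<longleftrightarrow>
     (\<forall>x. f differentiable (at x)) \<and>
     (\<forall>v. times_cont_diff n (\<lambda>x. frechet_derivative f (at x) v))"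

definition smooth :: "('a::real_normed_vector \<Rightarrow> 'b::real_normed_vector) \<Rightarrow> bool" where
  "smooth f \<longleftrightarrow> (\<forall>n. times_cont_diff n f)"

end

theory Submission
  imports Defs "HOL-Probability.Probability"
begin

text \<open>
  Write \<open>J\<^sub>\<nu>(z) = (z/2)\<^sup>\<nu> \<phi>\<^sub>\<nu>(z\<^sup>2/4)\<close> with \<open>\<phi>\<^sub>\<nu>\<close> entire (\<open>bessel_clifford\<close>). In the integral that defines the
  covariance all fractional powers of \<open>r\<close> then cancel, and what is left is
  \<open>C(x) = A \<integral> k\<^sup>d\<^sup>-\<^sup>1 p(k) \<phi>\<^sub>\<nu>(k\<^sup>2 \<bar>x\<bar>\<^sup>2 / 4) dk\<close> over \<open>[0, k\<^sub>c]\<close>, with \<open>A > 0\<close>, \<open>\<nu> = d/2 - 1\<close> and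
  \<open>p(k) = c\<^sub>0 + c\<^sub>1 k\<^sup>2 + c\<^sub>2 k\<^sup>4\<close> (\<open>bl_profile_eq\<close>). This expression makes sense at \<open>x = 0\<close> too and agrees
  there with the prescribed limit (\<open>bl_cov_eq\<close>). The assertions follow from it separately.

  \<^item> Closed form. Integration by parts, based on \<open>(t\<^sup>\<nu>\<^sup>+\<^sup>1 \<phi>\<^sub>\<nu>\<^sub>+\<^sub>1(t))' = t\<^sup>\<nu> \<phi>\<^sub>\<nu>(t)\<close>, gives a recursion in \<open>l\<close>
    for the integrals of \<open>k\<^sup>d\<^sup>-\<^sup>1\<^sup>+\<^sup>2\<^sup>l \<phi>\<^sub>\<nu>\<close> (\<open>has_integral_bessel_moment\<close>). For positive odd \<open>\<mu> - \<nu>\<close> the Lommel functions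
    \<open>S\<^sub>\<mu>\<^sub>,\<^sub>\<nu>\<close> terminate, because the Bessel part of \<open>S\<close> cancels all but finitely many terms of
    \<open>s\<^sub>\<mu>\<^sub>,\<^sub>\<nu>\<close> (\<open>lommel_S_closed_form\<close>), and the finite sums satisfy a recursion in \<open>l\<close> under which the bracket
    \<open>(2\<nu>+2l) J\<^sub>\<nu> S - J\<^sub>\<nu>\<^sub>-\<^sub>1 S\<close> obeys the same recursion as the integrals (\<open>lommel_bracket\<close>).

  \<^item> Non-negative definiteness. For \<open>\<eta>\<^sub>1 > -2\<close> the polynomial \<open>p\<close> is non-negative, so it is enough that
    \<open>x \<mapsto> \<phi>\<^sub>\<nu>(k\<^sup>2 \<bar>x\<bar>\<^sup>2 / 4)\<close> is non-negative definite for each \<open>k > 0\<close>. Up to a factor it is the Fourier transform of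
    the uniform measure on the sphere of radius \<open>k\<close>. Surface measure is avoided by working with solid
    balls: their Fourier transform is a multiple of \<open>s\<^sup>d \<phi>\<^sub>\<nu>\<^sub>+\<^sub>1(s\<^sup>2 \<bar>x\<bar>\<^sup>2 / 4)\<close> (\<open>integral_cball_cos\<close>). A quadratic
    form built from it increases with the radius \<open>s\<close>, since it integrates a non-negative function over growing
    balls; hence its derivative in \<open>s\<close>, which is the wanted quadratic form, is non-negative
    (\<open>nonneg_definite_bessel_clifford\<close>). The Fourier transform of a ball is found termwise from the moments
    of \<open>y \<mapsto> x \<bullet> y\<close> on the ball, and these come from Gaussian moments by slicing the
    Gaussian density into balls (\<open>nn_integral_cball_moment\<close>).

  \<^item> Smoothness. \<open>C(x)\<close> is an everywhere convergent power series in \<open>x \<bullet> x\<close> (\<open>band_integral_powser\<close>), and such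
    functions have derivatives of all orders (\<open>times_cont_diff_powser_inner\<close>).
\<close>


section \<open>The entire factor of the Bessel function\<close>

definition bessel_clifford_coeff :: "real \<Rightarrow> nat \<Rightarrow> real" where
  "bessel_clifford_coeff \<nu> m = (-1) ^ m * rGamma (\<nu> + real m + 1) / fact m"

text \<open>
  The function \<open>\<phi>\<^sub>\<nu>\<close>; in the usual notation it is the Bessel-Clifford function of order \<open>\<nu>\<close> at \<open>-t\<close>. It is
  entire in \<open>t\<close> for every real \<open>\<nu>\<close>, negative integers included.
\<close>
definition bessel_clifford :: "real \<Rightarrow> real \<Rightarrow> real" where
  "bessel_clifford \<nu> t = (\<Sum>m. bessel_clifford_coeff \<nu> m * t ^ m)"

lemma bessel_clifford_coeff_Suc:
  "bessel_clifford_coeff \<nu> m = - (real m + 1) * (\<nu> + real m + 1) * bessel_clifford_coeff \<nu> (Suc m)"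
proof -
  have "rGamma (\<nu> + real m + 1) = (\<nu> + real m + 1) * rGamma (\<nu> + real m + 1 + 1)"
    by (rule rGamma_plus1 [symmetric])
  moreover have "\<nu> + real m + 1 + 1 = \<nu> + real (Suc m) + 1"
    by simp
  ultimately have *: "rGamma (\<nu> + real m + 1) = (\<nu> + real m + 1) * rGamma (\<nu> + real (Suc m) + 1)"
    by metis
  show ?thesis
    unfolding bessel_clifford_coeff_def * by (simp add: divide_simps) (simp add: algebra_simps)
qed

lemma bessel_clifford_coeff_shift:
  "bessel_clifford_coeff \<nu> m = (\<nu> + real m + 1) * bessel_clifford_coeff (\<nu> + 1) m"
proof -
  have "rGamma (\<nu> + real m + 1) = (\<nu> + real m + 1) * rGamma (\<nu> + real m + 1 + 1)"
    by (rule rGamma_plus1 [symmetric])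
  moreover have "\<nu> + real m + 1 + 1 = \<nu> + 1 + real m + 1"
    by simp
  ultimately have *: "rGamma (\<nu> + real m + 1) = (\<nu> + real m + 1) * rGamma (\<nu> + 1 + real m + 1)"
    by metis
  show ?thesis
    unfolding bessel_clifford_coeff_def * by simp
qed

lemma diffs_bessel_clifford_coeff:
  "diffs (bessel_clifford_coeff \<nu>) m = - bessel_clifford_coeff (\<nu> + 1) m"
proof -
  have "\<nu> + real (Suc m) + 1 = \<nu> + 1 + real m + 1"
    by simp
  hence *: "rGamma (\<nu> + real (Suc m) + 1) = rGamma (\<nu> + 1 + real m + 1)"
    by metis
  show ?thesis
    unfolding diffs_def bessel_clifford_coeff_def * by (simp add: divide_simps)
qed

lemma summable_bessel_clifford: "summable (\<lambda>m. bessel_clifford_coeff \<nu> m * t ^ m)"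
proof -
  \<comment> \<open>from this index on, \<open>\<nu> + m + 1\<close> exceeds \<open>2 \<bar>t\<bar>\<close> and the ratio of successive terms is at most \<open>1/2\<close>\<close>
  obtain N :: nat where N: "real N > \<bar>\<nu>\<bar> + 2 * \<bar>t\<bar>"
    using reals_Archimedean2 by blast
  show ?thesis
  proof (rule summable_ratio_test [of "1 / 2" N])
    fix m assume "m \<ge> N"
    hence pos: "\<nu> + real m + 1 \<ge> 2 * \<bar>t\<bar> + 1"
      using N by linarith
    define c where "c = bessel_clifford_coeff \<nu> (Suc m)"
    have "2 * \<bar>t\<bar> \<le> 1 * (\<nu> + real m + 1)"
      using pos by simp
    also have "\<dots> \<le> (real m + 1) * (\<nu> + real m + 1)"
      by (rule mult_right_mono) (use pos in auto)
    finally have "\<bar>c\<bar> * \<bar>t\<bar> ^ m * (2 * \<bar>t\<bar>) \<le> \<bar>c\<bar> * \<bar>t\<bar> ^ m * ((real m + 1) * (\<nu> + real m + 1))"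
      by (rule mult_left_mono) auto
    moreover have "\<bar>bessel_clifford_coeff \<nu> m\<bar> = (real m + 1) * (\<nu> + real m + 1) * \<bar>c\<bar>"
      unfolding bessel_clifford_coeff_Suc [of \<nu> m] c_def [symmetric] using pos
      by (simp add: abs_mult)
    ultimately show "norm (bessel_clifford_coeff \<nu> (Suc m) * t ^ Suc m)
        \<le> 1 / 2 * norm (bessel_clifford_coeff \<nu> m * t ^ m)"
      unfolding c_def [symmetric] by (simp add: abs_mult power_abs mult_ac)
  qed auto
qed

lemma DERIV_bessel_clifford:
  "(bessel_clifford \<nu> has_real_derivative - bessel_clifford (\<nu> + 1) t) (at t)"
proof -
  have "((\<lambda>t. \<Sum>m. bessel_clifford_coeff \<nu> m * t ^ m) has_real_derivative
          (\<Sum>m. diffs (bessel_clifford_coeff \<nu>) m * t ^ m)) (at t)"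
    by (rule termdiffs_strong_converges_everywhere) (rule summable_bessel_clifford)
  thus ?thesis
    by (simp add: diffs_bessel_clifford_coeff bessel_clifford_def [abs_def]
        suminf_minus [OF summable_bessel_clifford])
qed

lemmas DERIV_bessel_clifford_chain [derivative_intros] =
  DERIV_bessel_clifford [THEN DERIV_chain2]

lemma continuous_on_bessel_clifford [continuous_intros]:
  "continuous_on A f \<Longrightarrow> continuous_on A (\<lambda>x. bessel_clifford \<nu> (f x))"
  using continuous_on_compose2 [of UNIV "bessel_clifford \<nu>" A f]
    continuous_at_imp_continuous_on [of UNIV "bessel_clifford \<nu>"]
    DERIV_isCont [OF DERIV_bessel_clifford]
  by simp

text \<open>This is \<open>J\<^sub>\<nu> + J\<^sub>\<nu>\<^sub>+\<^sub>2 = (2(\<nu>+1)/z) J\<^sub>\<nu>\<^sub>+\<^sub>1\<close>, freed from powers of \<open>z\<close>; it holds coefficient by coefficient.\<close>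
lemma bessel_clifford_recurrence:
  "bessel_clifford \<nu> t = (\<nu> + 1) * bessel_clifford (\<nu> + 1) t - t * bessel_clifford (\<nu> + 2) t"
proof -
  let ?f = "\<lambda>m. real m * bessel_clifford_coeff (\<nu> + 1) m * t ^ m"
  have "(\<lambda>m. - t * (bessel_clifford_coeff (\<nu> + 2) m * t ^ m))
          sums (- t * bessel_clifford (\<nu> + 2) t)"
    unfolding bessel_clifford_def
    by (intro sums_mult summable_sums summable_bessel_clifford)
  also have "(\<lambda>m. - t * (bessel_clifford_coeff (\<nu> + 2) m * t ^ m)) = (\<lambda>m. ?f (Suc m))"
    using diffs_bessel_clifford_coeff [of "\<nu> + 1"]
    by (auto simp: diffs_def fun_eq_iff add_ac)
  finally have "?f sums (- t * bessel_clifford (\<nu> + 2) t + ?f 0)"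
    by (rule sums_Suc)
  moreover have "(\<lambda>m. (\<nu> + 1) * (bessel_clifford_coeff (\<nu> + 1) m * t ^ m))
      sums ((\<nu> + 1) * bessel_clifford (\<nu> + 1) t)"
    unfolding bessel_clifford_def
    by (intro sums_mult summable_sums summable_bessel_clifford)
  ultimately have "(\<lambda>m. (\<nu> + 1) * (bessel_clifford_coeff (\<nu> + 1) m * t ^ m) + ?f m)
      sums ((\<nu> + 1) * bessel_clifford (\<nu> + 1) t + (- t * bessel_clifford (\<nu> + 2) t + ?f 0))"
    by (intro sums_add)
  also have "(\<lambda>m. (\<nu> + 1) * (bessel_clifford_coeff (\<nu> + 1) m * t ^ m) + ?f m)
      = (\<lambda>m. bessel_clifford_coeff \<nu> m * t ^ m)"
    by (auto simp: fun_eq_iff bessel_clifford_coeff_shift [of \<nu>] algebra_simps)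
  finally show ?thesis
    unfolding bessel_clifford_def [of \<nu>] by (simp add: sums_iff)
qed

lemma bessel_J_conv_bessel_clifford:
  assumes "z > 0"
  shows "bessel_J \<nu> z = (z / 2) powr \<nu> * bessel_clifford \<nu> (z\<^sup>2 / 4)"
proof -
  have "(z / 2) ^ (2 * m) = (z\<^sup>2 / 4) ^ m" for m
    by (simp add: power_mult power_divide)
  thus ?thesis
    using assms by (simp add: bessel_J_def bessel_clifford_def bessel_clifford_coeff_def)
qed


section \<open>Terminating Lommel functions\<close>

text \<open>
  The value of \<open>S\<^sub>\<nu>\<^sub>+\<^sub>2\<^sub>l\<^sub>+\<^sub>1\<^sub>,\<^sub>\<nu>\<close>. The recursion is the general identity
  \<open>S\<^sub>\<mu>\<^sub>+\<^sub>2\<^sub>,\<^sub>\<nu>(z) = z\<^sup>\<mu>\<^sup>+\<^sup>1 - ((\<mu>+1)\<^sup>2 - \<nu>\<^sup>2) S\<^sub>\<mu>\<^sub>,\<^sub>\<nu>(z)\<close> at \<open>\<mu> = \<nu> + 2l + 1\<close>.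
\<close>
fun lommel_poly :: "nat \<Rightarrow> real \<Rightarrow> real \<Rightarrow> real" where
  "lommel_poly 0 \<nu> z = z powr \<nu>"
| "lommel_poly (Suc l) \<nu> z =
     z powr (\<nu> + 2 * real l + 2) - 4 * (real l + 1) * (\<nu> + real l + 1) * lommel_poly l \<nu> z"

lemma isCont_lommel_poly:
  assumes "z > 0" 
  shows "isCont (\<lambda>\<nu>. lommel_poly l \<nu> z) \<nu>"
  by (induction l) (use assms in \<open>auto intro!: continuous_intros\<close>)

definition lommel_den :: "real \<Rightarrow> real \<Rightarrow> nat \<Rightarrow> real" where
  "lommel_den \<mu> \<nu> k = (\<Prod>j\<le>k. (\<mu> + 1 + 2 * real j)\<^sup>2 - \<nu>\<^sup>2)"

lemma lommel_den_shift:
  "lommel_den \<mu> \<nu> (Suc k) = ((\<mu> + 1)\<^sup>2 - \<nu>\<^sup>2) * lommel_den (\<mu> + 2) \<nu> k"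
  unfolding lommel_den_def by (subst prod.atMost_Suc_shift) (simp add: algebra_simps)

lemma lommel_s_conv:
  "lommel_s \<mu> \<nu> z = z powr (\<mu> + 1) * (\<Sum>k. (-1) ^ k * z ^ (2 * k) / lommel_den \<mu> \<nu> k)"
  by (simp add: lommel_s_def lommel_den_def)

text \<open>The series of \<open>s\<^sub>\<mu>\<^sub>+\<^sub>2\<^sub>,\<^sub>\<nu>\<close> is the series of \<open>s\<^sub>\<mu>\<^sub>,\<^sub>\<nu>\<close> without its first term, rescaled.\<close>
lemma lommel_s_step:
  assumes z: "z > 0" and D: "(\<mu> + 1)\<^sup>2 - \<nu>\<^sup>2 \<noteq> 0"
    and summ: "summable (\<lambda>k. (-1) ^ k * z ^ (2 * k) / lommel_den \<mu> \<nu> k)"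
  shows "summable (\<lambda>k. (-1) ^ k * z ^ (2 * k) / lommel_den (\<mu> + 2) \<nu> k)" (is ?A)
    and "lommel_s (\<mu> + 2) \<nu> z = z powr (\<mu> + 1) - ((\<mu> + 1)\<^sup>2 - \<nu>\<^sup>2) * lommel_s \<mu> \<nu> z" (is ?B)
proof -
  define D where "D = (\<mu> + 1)\<^sup>2 - \<nu>\<^sup>2"
  define f where "f = (\<lambda>k. (-1) ^ k * z ^ (2 * k) / lommel_den \<mu> \<nu> k)"
  have D0: "D \<noteq> 0" using D by (simp add: D_def)
  have f0: "f 0 = 1 / D"
    by (simp add: f_def lommel_den_def D_def)
  have eq: "(-1) ^ k * z ^ (2 * k) / lommel_den (\<mu> + 2) \<nu> k = - D / z\<^sup>2 * f (Suc k)" for k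
    unfolding f_def lommel_den_shift D_def [symmetric] using D0 z
    by (simp add: power2_eq_square)
  have "f sums suminf f"
    using summ unfolding f_def by (rule summable_sums)
  hence "(\<lambda>k. f (Suc k)) sums (suminf f - f 0)"
    by (subst sums_Suc_iff) simp
  hence "(\<lambda>k. - D / z\<^sup>2 * f (Suc k)) sums (- D / z\<^sup>2 * (suminf f - f 0))"
    by (rule sums_mult)
  hence s: "(\<lambda>k. (-1) ^ k * z ^ (2 * k) / lommel_den (\<mu> + 2) \<nu> k) sums (- D / z\<^sup>2 * (suminf f - f 0))"
    by (simp add: eq)
  thus ?A by (rule sums_summable)
  have "z powr (\<mu> + 2 + 1) = z powr (\<mu> + 1) * z\<^sup>2"
    using z by (simp add: powr_add [symmetric] add_ac flip: powr_numeral)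
  hence "lommel_s (\<mu> + 2) \<nu> z = z powr (\<mu> + 1) * z\<^sup>2 * (- D / z\<^sup>2 * (suminf f - f 0))"
    unfolding lommel_s_conv using sums_unique [OF s] by simp
  also have "\<dots> = z powr (\<mu> + 1) - D * (z powr (\<mu> + 1) * suminf f)"
    using z D0 by (simp add: f0 field_simps)
  finally show ?B
    unfolding lommel_s_conv D_def f_def .
qed

lemma not_Ints_add:
  fixes \<nu> :: real
  assumes "\<nu> \<notin> \<int>" "a \<in> \<int>"
  shows "\<nu> + a \<notin> \<int>"
  using assms Ints_diff [of "\<nu> + a" a] by auto

lemma Gamma_not_Ints:
  fixes \<nu> :: real
  assumes "\<nu> \<notin> \<int>"
  shows "Gamma \<nu> \<noteq> 0" "Gamma (\<nu> + 1) = \<nu> * Gamma \<nu>"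
proof -
  have "\<nu> \<notin> \<int>\<^sub>\<le>\<^sub>0"
    using assms nonpos_Ints_Int by blast
  thus "Gamma \<nu> \<noteq> 0" "Gamma (\<nu> + 1) = \<nu> * Gamma \<nu>"
    by (simp_all add: Gamma_eq_zero_iff Gamma_plus1)
qed

text \<open>
  On the diagonal \<open>\<mu> = \<nu> + 1\<close> each factor of the denominator splits as \<open>4 (j+1) (\<nu>+1+j)\<close>, so that the series of
  \<open>s\<^sub>\<nu>\<^sub>+\<^sub>1\<^sub>,\<^sub>\<nu>\<close> has the coefficients of \<open>\<phi>\<^sub>\<nu>\<close>, shifted by one, up to a constant factor and powers of \<open>4\<close>.
\<close>
lemma lommel_den_diagonal:
  assumes "\<nu> \<notin> \<int>"
  shows "1 / lommel_den (\<nu> + 1) \<nu> k = Gamma (\<nu> + 1) * rGamma (\<nu> + real k + 2) / (4 ^ (k + 1) * fact (k + 1))"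
proof (induction k)
  case 0
  have N: "\<nu> + 1 \<notin> \<int>"
    using not_Ints_add [OF assms, of 1] by simp
  hence ne: "\<nu> + 1 \<noteq> 0"
    by (metis Ints_0)
  have "Gamma (\<nu> + 1) * rGamma (\<nu> + 1) = 1"
    using Gamma_not_Ints(1) [OF N] by (simp add: rGamma_inverse_Gamma)
  moreover have "rGamma (\<nu> + 1) = (\<nu> + 1) * rGamma (\<nu> + 1 + 1)"
    by (rule rGamma_plus1 [symmetric])
  moreover have "\<nu> + 1 + 1 = \<nu> + real 0 + 2"
    by simp
  ultimately have "Gamma (\<nu> + 1) * ((\<nu> + 1) * rGamma (\<nu> + real 0 + 2)) = 1"
    by metis
  thus ?case using ne
    by (simp add: lommel_den_def power2_eq_square field_simps)
next
  case (Suc k)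
  have ne: "\<nu> + real k + 2 \<noteq> 0" using assms
    using not_Ints_add [OF assms, of "real k + 2"] by (metis Ints_0 Ints_add Ints_numeral Ints_of_nat add.assoc)
  have "lommel_den (\<nu> + 1) \<nu> (Suc k) = lommel_den (\<nu> + 1) \<nu> k * (4 * (real k + 2) * (\<nu> + real k + 2))"
    by (simp add: lommel_den_def power2_eq_square algebra_simps)
  hence "1 / lommel_den (\<nu> + 1) \<nu> (Suc k) = 1 / lommel_den (\<nu> + 1) \<nu> k / (4 * (real k + 2) * (\<nu> + real k + 2))"
    by simp
  also note Suc.IH
  also have "rGamma (\<nu> + real k + 2) = (\<nu> + real k + 2) * rGamma (\<nu> + real k + 2 + 1)"
    by (rule rGamma_plus1 [symmetric])
  also have "\<nu> + real k + 2 + 1 = \<nu> + real (Suc k) + 2"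
    by simp
  also have "Gamma (\<nu> + 1) * ((\<nu> + real k + 2) * rGamma (\<nu> + real (Suc k) + 2)) / (4 ^ (k + 1) * fact (k + 1)) /
      (4 * (real k + 2) * (\<nu> + real k + 2)) 
      = Gamma (\<nu> + 1) * rGamma (\<nu> + real (Suc k) + 2) / (4 ^ (Suc k + 1) * fact (Suc k + 1))"
    using ne by (simp add: divide_simps)
  finally show ?case .
qed

text \<open>
  For \<open>l = 0\<close> the series of \<open>s\<^sub>\<nu>\<^sub>+\<^sub>1\<^sub>,\<^sub>\<nu>\<close> is, up to a factor, the series of \<open>J\<^sub>\<nu>\<close> without its first term, and that
  missing term is \<open>z\<^sup>\<nu>\<close>. Each further step applies \<open>lommel_s_step\<close>. Summability is carried along because that
  step needs it.
\<close>
lemma lommel_s_closed_form: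
  assumes z: "z > 0" and \<nu>: "\<nu> \<notin> \<int>"
  shows "summable (\<lambda>k. (-1) ^ k * z ^ (2 * k) / lommel_den (\<nu> + 2 * real l + 1) \<nu> k) \<and>
    lommel_s (\<nu> + 2 * real l + 1) \<nu> z = lommel_poly l \<nu> z
      - (-1) ^ l * 2 powr (\<nu> + 2 * real l) * fact l * Gamma (\<nu> + real l + 1) * bessel_J \<nu> z"
proof (induction l)
  case 0
  let ?t = "z\<^sup>2 / 4" and ?c = "bessel_clifford_coeff \<nu>"
  have G: "Gamma (\<nu> + 1) \<noteq> 0"
    using \<nu> by (intro Gamma_not_Ints not_Ints_add) auto
  have eq: "(-1) ^ k * z ^ (2 * k) / lommel_den (\<nu> + 1) \<nu> k
      = - Gamma (\<nu> + 1) / z\<^sup>2 * (?c (Suc k) * ?t ^ Suc k)" for k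
  proof -
    have "(-1) ^ k * z ^ (2 * k) / lommel_den (\<nu> + 1) \<nu> k
        = (-1) ^ k * z ^ (2 * k) * (1 / lommel_den (\<nu> + 1) \<nu> k)"
      by simp
    also have "\<dots> = - Gamma (\<nu> + 1) / z\<^sup>2 * (?c (Suc k) * ?t ^ Suc k)"
      unfolding lommel_den_diagonal [OF \<nu>] bessel_clifford_coeff_def
      using z by (simp add: power_divide power_mult add_ac divide_simps)
    finally show ?thesis .
  qed
  have "(\<lambda>k. ?c k * ?t ^ k) sums bessel_clifford \<nu> ?t"
    unfolding bessel_clifford_def by (intro summable_sums summable_bessel_clifford)
  hence "(\<lambda>k. ?c (Suc k) * ?t ^ Suc k) sums (bessel_clifford \<nu> ?t - ?c 0)"
    by (subst sums_Suc_iff) simp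
  hence "(\<lambda>k. - Gamma (\<nu> + 1) / z\<^sup>2 * (?c (Suc k) * ?t ^ Suc k))
      sums (- Gamma (\<nu> + 1) / z\<^sup>2 * (bessel_clifford \<nu> ?t - ?c 0))"
    by (rule sums_mult)
  hence s: "(\<lambda>k. (-1) ^ k * z ^ (2 * k) / lommel_den (\<nu> + 1) \<nu> k)
      sums (- Gamma (\<nu> + 1) / z\<^sup>2 * (bessel_clifford \<nu> ?t - ?c 0))"
    by (simp only: eq)
  have "z powr (\<nu> + 1 + 1) = z powr \<nu> * z\<^sup>2"
    using z by (simp add: powr_add [symmetric] add_ac flip: powr_numeral)
  hence "lommel_s (\<nu> + 1) \<nu> z = z powr \<nu> * z\<^sup>2 * (- Gamma (\<nu> + 1) / z\<^sup>2 * (bessel_clifford \<nu> ?t - ?c 0))"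
    unfolding lommel_s_conv using sums_unique [OF s] by simp
  also have "\<dots> = z powr \<nu> * (Gamma (\<nu> + 1) * ?c 0) - Gamma (\<nu> + 1) * (z powr \<nu> * bessel_clifford \<nu> ?t)"
    using z by (simp add: field_simps)
  also have "Gamma (\<nu> + 1) * ?c 0 = 1"
    using G by (simp add: bessel_clifford_coeff_def rGamma_inverse_Gamma)
  also have "z powr \<nu> * bessel_clifford \<nu> ?t = 2 powr \<nu> * bessel_J \<nu> z"
    using z by (simp add: bessel_J_conv_bessel_clifford powr_divide)
  finally show ?case
    using sums_summable [OF s] by (simp add: mult_ac)
next
  case (Suc l)
  let ?\<mu> = "\<nu> + 2 * real l + 1"
  have ne: "\<nu> + real l + 1 \<noteq> 0" 
    using not_Ints_add [OF \<nu>, of "real l + 1"] by (metis Ints_0 Ints_add Ints_1 Ints_of_nat add.assoc)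
  have D: "(?\<mu> + 1)\<^sup>2 - \<nu>\<^sup>2 = 4 * (real l + 1) * (\<nu> + real l + 1)"
    by (simp add: power2_eq_square algebra_simps)
  have \<mu>: "\<nu> + 2 * real (Suc l) + 1 = ?\<mu> + 2" "?\<mu> + 1 = \<nu> + 2 * real l + 2"
    by simp_all
  have D0: "(?\<mu> + 1)\<^sup>2 - \<nu>\<^sup>2 \<noteq> 0"
    unfolding D using ne by simp
  note step = lommel_s_step [OF z D0 conjunct1 [OF Suc.IH]]
  have pw: "2 powr (\<nu> + 2 * real (Suc l)) = 4 * 2 powr (\<nu> + 2 * real l)"
    by (simp add: powr_add)
  have "\<nu> + real l + 1 \<notin> \<int>"
    using not_Ints_add [OF \<nu>, of "real l + 1"] by (simp add: add_ac)
  from Gamma_not_Ints(2) [OF this]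
  have "Gamma (\<nu> + real (Suc l) + 1) = (\<nu> + real l + 1) * Gamma (\<nu> + real l + 1)"
    by (simp add: add_ac)
  hence "lommel_s (?\<mu> + 2) \<nu> z = lommel_poly (Suc l) \<nu> z
      - (-1) ^ Suc l * 2 powr (\<nu> + 2 * real (Suc l)) * fact (Suc l) * Gamma (\<nu> + real (Suc l) + 1) * bessel_J \<nu> z"
    unfolding step(2) D conjunct2 [OF Suc.IH] pw by (simp add: algebra_simps)
  with step(1) show ?case
    unfolding \<mu> by blast
qed

text \<open>
  For odd \<open>\<mu> - \<nu>\<close> the coefficient of \<open>J\<^sub>-\<^sub>\<nu>\<close> vanishes and \<open>sin(\<nu>\<pi>)\<close> cancels; the remaining multiple of \<open>J\<^sub>\<nu>\<close> is
  exactly the one that separates \<open>s\<^sub>\<mu>\<^sub>,\<^sub>\<nu>\<close> from a finite sum.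
\<close>
lemma lommel_S_generic_closed_form:
  assumes z: "z > 0" and \<nu>: "\<nu> \<notin> \<int>"
  shows "lommel_S_generic (\<nu> + 2 * real l + 1) \<nu> z = lommel_poly l \<nu> z"
proof -
  have "sin (\<nu> * pi) \<noteq> 0"
    using \<nu> by (auto simp: sin_zero_iff_int2)
  moreover have "cos (real l * pi + pi / 2) = 0"
    by (simp add: cos_add)
  hence "cos ((\<nu> + 2 * real l + 1 - \<nu>) * pi / 2) = 0"
    by (simp add: field_simps)
  moreover have "cos (\<nu> * pi + real l * pi + pi / 2) = - ((-1) ^ l * sin (\<nu> * pi))"
    by (simp add: cos_add sin_add)
  hence "cos ((\<nu> + 2 * real l + 1 + \<nu>) * pi / 2) = - ((-1) ^ l * sin (\<nu> * pi))"
    by (simp add: field_simps)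
  moreover have "Gamma ((\<nu> + 2 * real l + 1 - \<nu> + 1) / 2) = fact l"
    by (simp add: Gamma_fact add_divide_distrib add.commute)
  moreover have "(\<nu> + 2 * real l + 1 + \<nu> + 1) / 2 = \<nu> + real l + 1"
    by (simp add: field_simps)
  moreover have "\<nu> + 2 * real l + 1 - 1 = \<nu> + 2 * real l"
    by simp
  ultimately show ?thesis
    unfolding lommel_S_generic_def conjunct2 [OF lommel_s_closed_form [OF assms]]
    by (simp only: add_ac) simp
qed

text \<open>
  Shifting both parameters by a small nonzero \<open>\<epsilon>\<close> keeps \<open>\<mu> - \<nu>\<close> odd and leads to a non-integer order, since the
  integers are isolated; the value for non-integer orders is continuous in the order.
\<close>
lemma lommel_S_closed_form:
  assumes z: "z > 0"
  shows "lommel_S (\<nu> + 2 * real l + 1) \<nu> z = lommel_poly l \<nu> z"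
proof -
  have "eventually (\<lambda>x. x \<in> - \<int>) (at \<nu>)"
    unfolding eventually_at_topological
    by (intro exI [of _ "- (\<int> - {\<nu>})"]) (auto simp del: Compl_Diff_eq intro!: open_Compl closed_subset_Ints)
  hence "eventually (\<lambda>\<epsilon>. \<nu> + \<epsilon> \<notin> \<int>) (at 0)"
    by (subst (asm) at_to_0) (simp add: eventually_filtermap add_ac)
  hence "eventually (\<lambda>\<epsilon>. lommel_poly l (\<nu> + \<epsilon>) z = lommel_S_generic (\<nu> + 2 * real l + 1 + \<epsilon>) (\<nu> + \<epsilon>) z) (at 0)"
    by eventually_elim (use lommel_S_generic_closed_form [OF z] in \<open>metis add.commute add.left_commute\<close>)
  moreover have "((\<lambda>\<epsilon>. lommel_poly l (\<nu> + \<epsilon>) z) \<longlongrightarrow> lommel_poly l \<nu> z) (at 0)"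
    using isCont_lommel_poly [OF z, of \<nu> l] by (simp add: isCont_iff)
  ultimately have "((\<lambda>\<epsilon>. lommel_S_generic (\<nu> + 2 * real l + 1 + \<epsilon>) (\<nu> + \<epsilon>) z) \<longlongrightarrow> lommel_poly l \<nu> z) (at 0)"
    by (rule Lim_transform_eventually [rotated])
  thus ?thesis
    unfolding lommel_S_def by (intro tendsto_Lim) auto
qed


section \<open>Power moments of the Bessel kernel\<close>

text \<open>
  For \<open>d = 2\<nu> + 2\<close> the integral of \<open>s\<^sup>d\<^sup>-\<^sup>1\<^sup>+\<^sup>2\<^sup>l \<phi>\<^sub>\<nu>(s\<^sup>2 r\<^sup>2 / 4)\<close> over \<open>[0, k]\<close> is \<open>k\<^sup>d / r\<^sup>2\<^sup>l\<close> times this function of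
  \<open>z = k r\<close>. The recursion is what two integrations by parts yield.
\<close>
fun bessel_moment :: "nat \<Rightarrow> real \<Rightarrow> real \<Rightarrow> real" where
  "bessel_moment 0 \<nu> z = bessel_clifford (\<nu> + 1) (z\<^sup>2 / 4) / 2"
| "bessel_moment (Suc l) \<nu> z =
     z ^ (2 * l) * ((2 * real l + 2) * bessel_clifford \<nu> (z\<^sup>2 / 4)
       + z\<^sup>2 / 2 * bessel_clifford (\<nu> + 1) (z\<^sup>2 / 4))
     - 4 * (real l + 1) * (\<nu> + real l + 1) * bessel_moment l \<nu> z"

text \<open>
  The identity \<open>(z\<^sup>\<nu>\<^sup>+\<^sup>1 J\<^sub>\<nu>\<^sub>+\<^sub>1)' = z\<^sup>\<nu>\<^sup>+\<^sup>1 J\<^sub>\<nu>\<close> in terms of \<open>\<phi>\<close>. It starts the recursion of the moments, and it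
  also turns the Fourier transform of a ball into that of a sphere.
\<close>
lemma DERIV_power_bessel_clifford:
  assumes d: "d \<ge> 1" "real d = 2 * \<nu> + 2"
  shows "((\<lambda>s. s ^ d * bessel_clifford (\<nu> + 1) (s\<^sup>2 * v)) has_real_derivative
           2 * (s ^ (d - 1) * bessel_clifford \<nu> (s\<^sup>2 * v))) (at s within A)"
proof -
  have pd: "s ^ d = s ^ (d - 1) * s"
    using d(1) by (metis One_nat_def power_minus_mult less_eq_Suc_le)
  have e: "\<nu> + 1 + 1 = \<nu> + 2"
    by simp
  have "((\<lambda>s. s ^ d * bessel_clifford (\<nu> + 1) (s\<^sup>2 * v)) has_real_derivative
      real d * s ^ (d - 1) * bessel_clifford (\<nu> + 1) (s\<^sup>2 * v)
      + s ^ d * (- bessel_clifford (\<nu> + 2) (s\<^sup>2 * v) * (2 * s * v))) (at s within A)"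
    by (rule derivative_eq_intros refl | simp add: e)+
  also have "real d * s ^ (d - 1) * bessel_clifford (\<nu> + 1) (s\<^sup>2 * v)
      + s ^ d * (- bessel_clifford (\<nu> + 2) (s\<^sup>2 * v) * (2 * s * v))
      = 2 * (s ^ (d - 1) * bessel_clifford \<nu> (s\<^sup>2 * v))"
    unfolding bessel_clifford_recurrence [of \<nu>] d(2) pd
    by (simp add: algebra_simps power2_eq_square)
  finally show ?thesis .
qed

text \<open>
  The right-hand side, as a function of \<open>k\<close>, has the integrand as its derivative: with
  \<open>t \<phi>\<^sub>\<nu>\<^sub>+\<^sub>2 = (\<nu>+1) \<phi>\<^sub>\<nu>\<^sub>+\<^sub>1 - \<phi>\<^sub>\<nu>\<close> all occurrences of \<open>\<phi>\<^sub>\<nu>\<^sub>+\<^sub>1\<close> cancel, and two consecutive moments of \<open>\<phi>\<^sub>\<nu>\<close> remain.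
\<close>
lemma has_integral_bessel_moment_parts:
  assumes d: "d \<ge> 1" "real d = 2 * \<nu> + 2" and k: "k \<ge> 0"
  shows "((\<lambda>s. 4 * (\<nu> + real l + 1) * (real l + 1) * (s ^ (d - 1 + 2 * l) * bessel_clifford \<nu> (s\<^sup>2 * v))
             + 4 * v * (s ^ (d - 1 + 2 * Suc l) * bessel_clifford \<nu> (s\<^sup>2 * v)))
           has_integral k ^ (d + 2 * l) * ((2 * real l + 2) * bessel_clifford \<nu> (k\<^sup>2 * v)
             + 2 * (k\<^sup>2 * v) * bessel_clifford (\<nu> + 1) (k\<^sup>2 * v))) {0..k}"
proof -
  define F where "F = (\<lambda>s. s ^ (d + 2 * l) * ((2 * real l + 2) * bessel_clifford \<nu> (s\<^sup>2 * v)
             + 2 * (s\<^sup>2 * v) * bessel_clifford (\<nu> + 1) (s\<^sup>2 * v)))"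
  define f where "f = (\<lambda>s. 4 * (\<nu> + real l + 1) * (real l + 1) * (s ^ (d - 1 + 2 * l) * bessel_clifford \<nu> (s\<^sup>2 * v))
             + 4 * v * (s ^ (d - 1 + 2 * Suc l) * bessel_clifford \<nu> (s\<^sup>2 * v)))"
  have "(F has_real_derivative f s) (at s within {0..k})" for s
  proof -
    let ?u = "bessel_clifford \<nu> (s\<^sup>2 * v)"
    let ?v = "bessel_clifford (\<nu> + 1) (s\<^sup>2 * v)"
    let ?w = "bessel_clifford (\<nu> + 2) (s\<^sup>2 * v)"
    let ?p = "s ^ (d - 1 + 2 * l)"
    have e: "\<nu> + 1 + 1 = \<nu> + 2"
      by simp
    have pd: "s ^ (d + 2 * l) = ?p * s" "s ^ (d - 1 + 2 * Suc l) = ?p * s\<^sup>2" "d + 2 * l - 1 = d - 1 + 2 * l"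
      using d(1) by (cases d; simp add: power_add power2_eq_square)+
    have rd: "real (d + 2 * l) = 2 * \<nu> + 2 + 2 * real l"
      using d(2) by simp
    have w: "s\<^sup>2 * v * ?w = (\<nu> + 1) * ?v - ?u"
      using bessel_clifford_recurrence [of \<nu> "s\<^sup>2 * v"] by simp
    have "(F has_real_derivative
        real (d + 2 * l) * s ^ (d + 2 * l - 1) * ((2 * real l + 2) * ?u + 2 * (s\<^sup>2 * v) * ?v)
        + s ^ (d + 2 * l) * ((2 * real l + 2) * (- ?v * (2 * s * v))
          + (2 * (2 * s * v) * ?v + 2 * (s\<^sup>2 * v) * (- ?w * (2 * s * v))))) (at s within {0..k})"
      unfolding F_def by (rule derivative_eq_intros refl | simp add: e)+
    also have "real (d + 2 * l) * s ^ (d + 2 * l - 1) * ((2 * real l + 2) * ?u + 2 * (s\<^sup>2 * v) * ?v)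
        + s ^ (d + 2 * l) * ((2 * real l + 2) * (- ?v * (2 * s * v))
          + (2 * (2 * s * v) * ?v + 2 * (s\<^sup>2 * v) * (- ?w * (2 * s * v))))
        = real (d + 2 * l) * ?p * ((2 * real l + 2) * ?u + 2 * (s\<^sup>2 * v) * ?v)
        + ?p * (s\<^sup>2 * v) * (2 * ((2 * real l + 2) * (- ?v))
          + 4 * ?v - 4 * (s\<^sup>2 * v * ?w))"
      unfolding pd by (simp add: algebra_simps power2_eq_square)
    also have "\<dots> = f s"
      unfolding f_def w rd pd by (simp add: algebra_simps)
    finally show ?thesis .
  qed
  hence "(f has_integral F k - F 0) {0..k}"
    by (intro fundamental_theorem_of_calculus k) (auto simp: has_real_derivative_iff_has_vector_derivative)
  moreover have "F 0 = 0"
    using d(1) by (simp add: F_def)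
  ultimately show ?thesis
    by (simp only: F_def f_def diff_zero)
qed

lemma has_integral_bessel_moment:
  assumes d: "d \<ge> 1" "real d = 2 * \<nu> + 2" and k: "k \<ge> 0" and r: "r > 0"
  shows "((\<lambda>s. s ^ (d - 1 + 2 * l) * bessel_clifford \<nu> (s\<^sup>2 * (r\<^sup>2 / 4))) has_integral
           k ^ d * bessel_moment l \<nu> (k * r) / r ^ (2 * l)) {0..k}"
proof (induction l)
  case 0
  let ?F = "\<lambda>s. s ^ d * bessel_clifford (\<nu> + 1) (s\<^sup>2 * (r\<^sup>2 / 4))"
  have "((\<lambda>s. 2 * (s ^ (d - 1) * bessel_clifford \<nu> (s\<^sup>2 * (r\<^sup>2 / 4)))) has_integral ?F k - ?F 0) {0..k}"
    by (intro fundamental_theorem_of_calculus k DERIV_power_bessel_clifford d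
        has_real_derivative_iff_has_vector_derivative [THEN iffD1])
  hence "((\<lambda>s. 1 / 2 * (2 * (s ^ (d - 1) * bessel_clifford \<nu> (s\<^sup>2 * (r\<^sup>2 / 4))))) has_integral 1 / 2 * (?F k - ?F 0)) {0..k}"
    by (rule has_integral_mult_right)
  moreover have "(0::real) ^ d = 0"
    using d(1) by (simp add: zero_power)
  ultimately show ?case
    by (simp add: power_mult_distrib)
next
  case (Suc l)
  let ?v = "r\<^sup>2 / 4"
  let ?c = "4 * (\<nu> + real l + 1) * (real l + 1)"
  let ?f = "\<lambda>l s. s ^ (d - 1 + 2 * l) * bessel_clifford \<nu> (s\<^sup>2 * ?v)"
  let ?J = "k ^ (d + 2 * l) * ((2 * real l + 2) * bessel_clifford \<nu> (k\<^sup>2 * ?v)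
             + 2 * (k\<^sup>2 * ?v) * bessel_clifford (\<nu> + 1) (k\<^sup>2 * ?v))"
  have "((\<lambda>s. (?c * ?f l s + 4 * ?v * ?f (Suc l) s) - ?c * ?f l s) has_integral
      ?J - ?c * (k ^ d * bessel_moment l \<nu> (k * r) / r ^ (2 * l))) {0..k}"
    by (intro has_integral_diff has_integral_mult_right Suc.IH has_integral_bessel_moment_parts d k)
  hence "((\<lambda>s. r\<^sup>2 * ?f (Suc l) s) has_integral
      ?J - ?c * (k ^ d * bessel_moment l \<nu> (k * r) / r ^ (2 * l))) {0..k}"
    by simp
  hence "((\<lambda>s. inverse (r\<^sup>2) * (r\<^sup>2 * ?f (Suc l) s)) has_integral
      inverse (r\<^sup>2) * (?J - ?c * (k ^ d * bessel_moment l \<nu> (k * r) / r ^ (2 * l)))) {0..k}"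
    by (rule has_integral_mult_right)
  moreover have "inverse (r\<^sup>2) * (?J - ?c * (k ^ d * bessel_moment l \<nu> (k * r) / r ^ (2 * l)))
      = k ^ d * bessel_moment (Suc l) \<nu> (k * r) / r ^ (2 * Suc l)"
  proof -
    have e: "(k * r)\<^sup>2 / 4 = k\<^sup>2 * ?v" "(k * r)\<^sup>2 / 2 = 2 * (k\<^sup>2 * ?v)"
      "(k * r) ^ (2 * l) = k ^ (2 * l) * r ^ (2 * l)" "r ^ (2 * Suc l) = r\<^sup>2 * r ^ (2 * l)"
      "k ^ (d + 2 * l) = k ^ d * k ^ (2 * l)"
      by (simp_all add: power_mult_distrib power_add power2_eq_square)
    have cancel: "inverse R * (K * L * X - c * (K * B / M)) = K * (L * M * X - c' * B) / (R * M)"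
      if "M \<noteq> 0" "R \<noteq> 0" "c = c'" for R K L X c c' B M :: real
      using that by (simp add: field_simps)
    show ?thesis
      unfolding bessel_moment.simps e by (rule cancel) (use r in \<open>auto simp: algebra_simps\<close>)
  qed
  moreover have "inverse (r\<^sup>2) * (r\<^sup>2 * t) = t" for t
    using r by simp
  ultimately show ?case
    by (simp only:)
qed

text \<open>
  Both sides obey the same first-order recursion in \<open>l\<close>. That of the bracket comes from the recursion of
  \<open>lommel_poly\<close> at the orders \<open>\<nu> - 1\<close> and \<open>\<nu>\<close>: the factors \<open>\<nu> + l\<close> and \<open>\<nu> + l + 1\<close> there combine with the factor
  \<open>2\<nu> + 2l + 2\<close> of the next bracket so that a multiple of the previous bracket splits off.
\<close>
lemma lommel_bracket:
  assumes z: "z > 0"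
  shows "z * ((2 * \<nu> + 2 * real l) * bessel_J \<nu> z * lommel_poly l (\<nu> - 1) z
           - bessel_J (\<nu> - 1) z * lommel_poly l \<nu> z)
         = z powr (2 * \<nu> + 2) * 2 powr (- \<nu>) * bessel_moment l \<nu> z"
proof (induction l)
  case 0
  let ?t = "z\<^sup>2 / 4"
  have rec: "bessel_clifford (\<nu> - 1) ?t = \<nu> * bessel_clifford \<nu> ?t - ?t * bessel_clifford (\<nu> + 1) ?t"
    using bessel_clifford_recurrence [of "\<nu> - 1" ?t] by (simp add: add.commute)
  have J: "bessel_J \<nu> z = z powr \<nu> * 2 powr (- \<nu>) * bessel_clifford \<nu> ?t"
    "bessel_J (\<nu> - 1) z = z powr \<nu> / z * (2 * 2 powr (- \<nu>)) * bessel_clifford (\<nu> - 1) ?t"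
    using z by (simp_all add: bessel_J_conv_bessel_clifford powr_divide powr_diff powr_minus field_simps)
  have p: "z powr (2 * \<nu> + 2) = z powr \<nu> * z powr \<nu> * z\<^sup>2" "z powr (\<nu> - 1) = z powr \<nu> / z"
    using z by (simp_all add: powr_add powr_diff flip: powr_numeral) (simp flip: powr_add)
  show ?case
    unfolding J rec p lommel_poly.simps bessel_moment.simps using z
    by (simp add: divide_simps power2_eq_square) (simp add: algebra_simps)
next
  case (Suc l)
  let ?t = "z\<^sup>2 / 4"
  let ?B = "(2 * \<nu> + 2 * real l) * bessel_J \<nu> z * lommel_poly l (\<nu> - 1) z
           - bessel_J (\<nu> - 1) z * lommel_poly l \<nu> z"
  have rec: "bessel_clifford (\<nu> - 1) ?t = \<nu> * bessel_clifford \<nu> ?t - ?t * bessel_clifford (\<nu> + 1) ?t"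
    using bessel_clifford_recurrence [of "\<nu> - 1" ?t] by (simp add: add.commute)
  have J: "bessel_J \<nu> z = z powr \<nu> * 2 powr (- \<nu>) * bessel_clifford \<nu> ?t"
    "bessel_J (\<nu> - 1) z = z powr \<nu> / z * (2 * 2 powr (- \<nu>)) * bessel_clifford (\<nu> - 1) ?t"
    using z by (simp_all add: bessel_J_conv_bessel_clifford powr_divide powr_diff powr_minus field_simps)
  have p: "z powr (2 * \<nu> + 2) = z powr \<nu> * z powr \<nu> * z\<^sup>2"
    "z powr (\<nu> + 2 * real l + 2) = z powr \<nu> * z ^ (2 * l) * z\<^sup>2"
    "z powr (\<nu> - 1 + 2 * real l + 2) = z powr \<nu> * z ^ (2 * l) * z"
  proof -
    show "z powr (2 * \<nu> + 2) = z powr \<nu> * z powr \<nu> * z\<^sup>2"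
      using z by (simp add: powr_add flip: powr_numeral) (simp flip: powr_add)
    have "z ^ (2 * l) = z powr (2 * real l)"
      using z by (simp flip: powr_realpow)
    thus "z powr (\<nu> + 2 * real l + 2) = z powr \<nu> * z ^ (2 * l) * z\<^sup>2"
      "z powr (\<nu> - 1 + 2 * real l + 2) = z powr \<nu> * z ^ (2 * l) * z"
      using z by (simp_all add: powr_add powr_diff power2_eq_square)
  qed
  have "z * ((2 * \<nu> + 2 * real (Suc l)) * bessel_J \<nu> z * lommel_poly (Suc l) (\<nu> - 1) z
           - bessel_J (\<nu> - 1) z * lommel_poly (Suc l) \<nu> z)
      = z * ((2 * \<nu> + 2 * real l + 2) * bessel_J \<nu> z * z powr (\<nu> - 1 + 2 * real l + 2)
           - bessel_J (\<nu> - 1) z * z powr (\<nu> + 2 * real l + 2))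
        - 4 * (real l + 1) * (\<nu> + real l + 1) * (z * ?B)"
    by (simp add: algebra_simps)
  also have "z * ((2 * \<nu> + 2 * real l + 2) * bessel_J \<nu> z * z powr (\<nu> - 1 + 2 * real l + 2)
           - bessel_J (\<nu> - 1) z * z powr (\<nu> + 2 * real l + 2))
      = z powr (2 * \<nu> + 2) * 2 powr (- \<nu>) * (z ^ (2 * l) * ((2 * real l + 2) * bessel_clifford \<nu> ?t
       + z\<^sup>2 / 2 * bessel_clifford (\<nu> + 1) ?t))"
    unfolding J rec p using z by (simp add: field_simps power2_eq_square)
  also note Suc.IH
  finally show ?case
    by (simp add: algebra_simps)
qed


section \<open>Gaussian moments and moments of balls\<close>

text \<open>The counterpart of \<open>nn_integral_lborel_prod\<close> for integrable factors, needed for characteristic functions.\<close>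
lemma integral_lborel_prod:
  fixes f :: "'a::euclidean_space \<Rightarrow> real \<Rightarrow> 'b::{real_normed_field,banach,second_countable_topology}"
  assumes "\<And>b. b \<in> Basis \<Longrightarrow> integrable lborel (f b)"
  shows "(LINT x|lborel. (\<Prod>b\<in>Basis. f b (x \<bullet> b))) = (\<Prod>b\<in>Basis. (LINT t|lborel. f b t))"
proof -
  interpret product_sigma_finite "\<lambda>_. lborel :: real measure" ..
  have [measurable]: "b \<in> Basis \<Longrightarrow> f b \<in> borel_measurable borel" for b
    using borel_measurable_integrable [OF assms] by simp
  have "(LINT x|lborel. (\<Prod>b\<in>Basis. f b (x \<bullet> b)))
      = (LINT g|(\<Pi>\<^sub>M b\<in>Basis. lborel). (\<Prod>b\<in>Basis. f b ((\<Sum>c\<in>Basis. g c *\<^sub>R c) \<bullet> b)))"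
    by (subst lborel_eq, subst integral_distr) auto
  also have "\<dots> = (LINT g|(\<Pi>\<^sub>M b\<in>Basis. lborel). (\<Prod>b\<in>Basis. f b (g b)))"
    by (intro Bochner_Integration.integral_cong prod.cong refl)
       (simp add: inner_sum_left inner_Basis if_distrib sum.delta cong: if_cong)
  also have "\<dots> = (\<Prod>b\<in>Basis. (LINT t|lborel. f b t))"
    by (rule product_integral_prod) (auto intro: assms)
  finally show ?thesis .
qed

definition std_gauss_density :: "'a::euclidean_space \<Rightarrow> real" where
  "std_gauss_density y = (\<Prod>b\<in>Basis. std_normal_density (y \<bullet> b))"

lemma std_gauss_density_eq:
  "std_gauss_density (y :: 'a::euclidean_space) = (2 * pi) powr (- real DIM('a) / 2) * exp (- (norm y)\<^sup>2 / 2)"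
proof -
  have "(\<Prod>b\<in>(Basis::'a set). exp (- (y \<bullet> b)\<^sup>2 / 2)) = exp (\<Sum>b\<in>Basis. - (y \<bullet> b)\<^sup>2 / 2)"
    by (rule exp_sum [symmetric]) auto
  also have "(\<Sum>b\<in>Basis. - (y \<bullet> b)\<^sup>2 / 2) = - (norm y)\<^sup>2 / 2"
    unfolding norm_eq_sqrt_inner euclidean_inner [of y y]
    by (simp add: sum_nonneg power2_eq_square sum_negf sum_divide_distrib)
  finally have *: "(\<Prod>b\<in>(Basis::'a set). exp (- (y \<bullet> b)\<^sup>2 / 2)) = exp (- (norm y)\<^sup>2 / 2)" .
  have "1 / sqrt (2 * pi) = (2 * pi) powr (- 1 / 2)"
    by (simp add: powr_minus powr_half_sqrt divide_simps)
  hence "(1 / sqrt (2 * pi)) ^ DIM('a) = (2 * pi) powr (- real DIM('a) / 2)"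
    by (simp add: powr_realpow [symmetric] powr_powr)
  thus ?thesis
    unfolding std_gauss_density_def std_normal_density_def prod.distrib * by simp
qed

lemma borel_measurable_std_gauss_density [measurable]: "std_gauss_density \<in> borel_measurable borel"
  unfolding std_gauss_density_def [abs_def] by measurable

lemma std_gauss_density_nonneg: "std_gauss_density y \<ge> 0"
  by (simp add: std_gauss_density_eq)

definition std_gauss :: "'a::euclidean_space measure" where
  "std_gauss = density lborel (\<lambda>y. ennreal (std_gauss_density y))"

lemma prob_space_std_gauss: "prob_space (std_gauss :: 'a::euclidean_space measure)"
proof
  let ?G = "std_gauss :: 'a measure"
  have "emeasure ?G (space ?G) = (\<integral>\<^sup>+y. ennreal (\<Prod>b\<in>Basis. std_normal_density ((y :: 'a) \<bullet> b)) \<partial>lborel)"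
    by (simp add: std_gauss_def std_gauss_density_def emeasure_density)
  also have "\<dots> = (\<integral>\<^sup>+y. (\<Prod>b\<in>Basis. ennreal (std_normal_density ((y :: 'a) \<bullet> b))) \<partial>lborel)"
    by (simp add: prod_ennreal)
  also have "\<dots> = (\<Prod>b\<in>(Basis :: 'a set). (\<integral>\<^sup>+t. ennreal (std_normal_density t) \<partial>lborel))"
    by (rule nn_integral_lborel_prod) auto
  also have "(\<integral>\<^sup>+t. ennreal (std_normal_density t) \<partial>lborel) = 1"
    using prob_space.emeasure_space_1 [OF prob_space_normal_density [of 1 0]]
    by (simp add: emeasure_density)
  finally show "emeasure ?G (space ?G) = 1"
    by simp
qed

text \<open>
  Under the standard Gaussian measure \<open>x \<bullet> y\<close> is normal with variance \<open>\<bar>x\<bar>\<^sup>2\<close>, because both sides have the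
  characteristic function \<open>exp(-t\<^sup>2 \<bar>x\<bar>\<^sup>2 / 2)\<close>. This yields the dependence on the norm of \<open>x\<close> alone without an
  appeal to rotations, and it includes \<open>x = 0\<close>.
\<close>
lemma distr_inner_std_gauss:
  fixes x :: "'a::euclidean_space"
  shows "distr std_gauss borel (\<lambda>y. x \<bullet> y) = distr std_normal_distribution borel (\<lambda>t. norm x * t)"
proof (rule Levy_uniqueness)
  interpret G: prob_space "std_gauss :: 'a measure"
    by (rule prob_space_std_gauss)
  interpret N: prob_space std_normal_distribution
    by (rule prob_space_normal_density) simp
  show "real_distribution (distr std_gauss borel (\<lambda>y. x \<bullet> y))"
    by (rule G.real_distribution_distr) (simp add: std_gauss_def)
  show "real_distribution (distr std_normal_distribution borel (\<lambda>t. norm x * t))"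
    by (rule N.real_distribution_distr) simp
  show "char (distr std_gauss borel (\<lambda>y. x \<bullet> y)) = char (distr std_normal_distribution borel (\<lambda>t. norm x * t))"
  proof
    fix t :: real
    let ?f = "\<lambda>b s. complex_of_real (std_normal_density s) * iexp (t * (x \<bullet> b) * s)"
    have int: "integrable lborel (?f b)" for b
      by (rule Bochner_Integration.integrable_bound [of _ std_normal_density])
         (auto simp: norm_mult)
    have ch: "(LINT s|lborel. ?f b s) = complex_of_real (exp (- (t * (x \<bullet> b))\<^sup>2 / 2))" for b
      using fun_cong [OF char_std_normal_distribution, of "t * (x \<bullet> b)"]
      unfolding char_def by (subst (asm) integral_density) (auto simp: scaleR_conv_of_real)
    have "char (distr std_gauss borel (\<lambda>y. x \<bullet> y)) t = (CLINT y|std_gauss. iexp (t * (x \<bullet> y)))"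
      unfolding char_def by (rule integral_distr) (auto simp: std_gauss_def)
    also have "\<dots> = (CLINT y|lborel. complex_of_real (std_gauss_density y) * iexp (t * (x \<bullet> y)))"
      unfolding std_gauss_def by (subst integral_density) (auto simp: std_gauss_density_nonneg scaleR_conv_of_real)
    also have "\<dots> = (CLINT y|lborel. (\<Prod>b\<in>Basis. ?f b (y \<bullet> b)))"
    proof (rule Bochner_Integration.integral_cong [OF refl])
      fix y :: 'a
      have "iexp (t * (x \<bullet> y)) = exp (\<Sum>b\<in>Basis. \<i> * complex_of_real (t * (x \<bullet> b) * (y \<bullet> b)))"
        by (subst euclidean_inner [of x y]) (simp add: sum_distrib_left mult_ac)
      also have "\<dots> = (\<Prod>b\<in>Basis. iexp (t * (x \<bullet> b) * (y \<bullet> b)))"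
        by (rule exp_sum) auto
      finally show "complex_of_real (std_gauss_density y) * iexp (t * (x \<bullet> y)) = (\<Prod>b\<in>Basis. ?f b (y \<bullet> b))"
        by (simp add: std_gauss_density_def prod.distrib)
    qed
    also have "\<dots> = (\<Prod>b\<in>Basis. (LINT s|lborel. ?f b s))"
      by (rule integral_lborel_prod) (rule int)
    also have "\<dots> = complex_of_real (\<Prod>b\<in>Basis. exp (- (t * (x \<bullet> b))\<^sup>2 / 2))"
      unfolding ch by simp
    also have "(\<Prod>b\<in>Basis. exp (- (t * (x \<bullet> b))\<^sup>2 / 2)) = exp (\<Sum>b\<in>Basis. - (t * (x \<bullet> b))\<^sup>2 / 2)"
      by (rule exp_sum [symmetric]) auto
    also have "(\<Sum>b\<in>Basis. - (t * (x \<bullet> b))\<^sup>2 / 2) = - (t * norm x)\<^sup>2 / 2"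
      unfolding norm_eq_sqrt_inner power_mult_distrib euclidean_inner [of x x]
      by (simp add: sum_nonneg power2_eq_square sum_negf sum_divide_distrib sum_distrib_left)
    also have "complex_of_real (exp (- (t * norm x)\<^sup>2 / 2)) = char std_normal_distribution (t * norm x)"
      by (simp add: char_std_normal_distribution)
    also have "\<dots> = char (distr std_normal_distribution borel (\<lambda>t. norm x * t)) t"
      unfolding char_def by (subst integral_distr) (auto simp: mult_ac)
    finally show "char (distr std_gauss borel (\<lambda>y. x \<bullet> y)) t
        = char (distr std_normal_distribution borel (\<lambda>t. norm x * t)) t" .
  qed
qed

lemma nn_integral_gauss_moment:
  fixes x :: "'a::euclidean_space"
  shows "(\<integral>\<^sup>+y. ennreal ((x \<bullet> y) ^ (2 * m) * exp (- (norm y)\<^sup>2 / 2)) \<partial>lborel)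
    = ennreal ((2 * pi) powr (real DIM('a) / 2) * norm x ^ (2 * m) * fact (2 * m) / (2 ^ m * fact m))"
proof -
  let ?c = "(2 * pi) powr (real DIM('a) / 2)"
  have c: "?c * (2 * pi) powr (- real DIM('a) / 2) = 1"
    by (simp flip: powr_add)
  have e: "(x \<bullet> y) ^ (2 * m) * exp (- (norm y)\<^sup>2 / 2) = ?c * (std_gauss_density y * (x \<bullet> y) ^ (2 * m))" for y
  proof -
    have "?c * (std_gauss_density y * (x \<bullet> y) ^ (2 * m))
        = (?c * (2 * pi) powr (- real DIM('a) / 2)) * ((x \<bullet> y) ^ (2 * m) * exp (- (norm y)\<^sup>2 / 2))"
      unfolding std_gauss_density_eq by (simp only: mult_ac)
    thus ?thesis by (simp only: c mult_1_left)
  qed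
  have "(\<integral>\<^sup>+y. ennreal ((x \<bullet> y) ^ (2 * m) * exp (- (norm y)\<^sup>2 / 2)) \<partial>lborel)
    = ennreal ?c * (\<integral>\<^sup>+y. ennreal (std_gauss_density y) * ennreal ((x \<bullet> y) ^ (2 * m)) \<partial>lborel)"
    unfolding e by (subst nn_integral_cmult [symmetric])
      (auto simp: ennreal_mult std_gauss_density_nonneg intro!: nn_integral_cong)
  also have "(\<integral>\<^sup>+y. ennreal (std_gauss_density y) * ennreal ((x \<bullet> y) ^ (2 * m)) \<partial>lborel)
      = (\<integral>\<^sup>+s. ennreal (s ^ (2 * m)) \<partial>distr std_gauss borel (\<lambda>y. x \<bullet> y))"
    by (subst nn_integral_distr) (auto simp: std_gauss_def nn_integral_density)
  also have "\<dots> = (\<integral>\<^sup>+t. ennreal ((norm x * t) ^ (2 * m)) \<partial>std_normal_distribution)"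
    unfolding distr_inner_std_gauss by (subst nn_integral_distr) auto
  also have "\<dots> = (\<integral>\<^sup>+t. ennreal (norm x ^ (2 * m) * (std_normal_density t * t ^ (2 * m))) \<partial>lborel)"
    by (subst nn_integral_density)
       (auto simp: power_mult_distrib mult_ac simp flip: ennreal_mult' intro!: nn_integral_cong)
  also have "\<dots> = ennreal (norm x ^ (2 * m) * (fact (2 * m) / (2 ^ m * fact m)))"
    by (rule nn_integral_eq_integral [THEN trans])
       (use normal_moment_even [of 1 0 m] in \<open>auto simp: has_bochner_integral_iff\<close>)
  finally show ?thesis
    by (simp add: mult_ac flip: ennreal_mult)
qed

text \<open>The integrand is homogeneous of degree \<open>2m\<close> and the volume element of degree \<open>d\<close>.\<close>
lemma nn_integral_cball_scale:
  fixes x :: "'a::euclidean_space"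
  assumes s: "s > 0"
  shows "(\<integral>\<^sup>+y. ennreal ((x \<bullet> y) ^ (2 * m)) * indicator (cball 0 s) y \<partial>lborel)
    = ennreal (s ^ (2 * m + DIM('a))) * (\<integral>\<^sup>+y. ennreal ((x \<bullet> y) ^ (2 * m)) * indicator (cball 0 1) y \<partial>lborel)"
proof -
  have [measurable]: "(indicator (cball 0 r) :: 'a \<Rightarrow> ennreal) \<in> borel_measurable borel" for r
    by (intro borel_measurable_indicator) simp
  have "(lborel :: 'a measure) = density (distr lborel borel (\<lambda>x. 0 + s *\<^sub>R x)) (\<lambda>_. \<bar>s\<bar> ^ DIM('a))"
    using s by (intro lborel_affine) auto
  hence "(\<integral>\<^sup>+y. ennreal ((x \<bullet> y) ^ (2 * m)) * indicator (cball 0 s) y \<partial>lborel)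
      = (\<integral>\<^sup>+y. ennreal ((x \<bullet> y) ^ (2 * m)) * indicator (cball 0 s) y \<partial>(density (distr lborel borel (\<lambda>x. 0 + s *\<^sub>R x)) (\<lambda>_. \<bar>s\<bar> ^ DIM('a))))"
    by (rule arg_cong)
  also have "\<dots> = (\<integral>\<^sup>+y. ennreal (s ^ DIM('a)) * (ennreal ((x \<bullet> (s *\<^sub>R y)) ^ (2 * m)) * indicator (cball 0 s) (s *\<^sub>R y)) \<partial>lborel)"
    using s by (simp add: nn_integral_density nn_integral_distr)
  also have "\<dots> = (\<integral>\<^sup>+y. ennreal (s ^ (2 * m + DIM('a))) * (ennreal ((x \<bullet> y) ^ (2 * m)) * indicator (cball 0 1) y) \<partial>lborel)"
    using s by (intro nn_integral_cong)
      (auto simp: power_mult_distrib power_add indicator_def mult_ac simp flip: ennreal_mult' ennreal_mult'')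
  also have "\<dots> = ennreal (s ^ (2 * m + DIM('a))) * (\<integral>\<^sup>+y. ennreal ((x \<bullet> y) ^ (2 * m)) * indicator (cball 0 1) y \<partial>lborel)"
    by (rule nn_integral_cmult) measurable
  finally show ?thesis .
qed

text \<open>
  With \<open>a = \<bar>y\<bar>\<^sup>2 / 2\<close> this writes the Gaussian density as a superposition of indicator functions of balls
  of radius \<open>\<surd>(2u)\<close>.
\<close>
lemma exp_layer_cake:
  assumes "a \<ge> 0"
  shows "ennreal (exp (- a)) = (\<integral>\<^sup>+u. ennreal (exp (- u)) * indicator {a..} u \<partial>lborel)"
proof -
  have "((\<lambda>u. exp (- 1 * u)) has_integral exp (- 1 * a) / 1) {a..}"
    by (rule has_integral_exp_minus_to_infinity) simp
  from nn_integral_has_integral_lebesgue [OF _ this] show ?thesis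
    by (simp add: ennreal_mult' ennreal_indicator mult_ac)
qed

text \<open>
  Let \<open>M\<close> be the moment over the unit ball and \<open>g = d/2 + m\<close>. Slicing the Gaussian density into balls and using
  homogeneity, the Gaussian moment equals \<open>M \<integral> e\<^sup>-\<^sup>u (2u)\<^sup>g du = 2\<^sup>g \<Gamma>(g+1) M\<close>, which determines \<open>M\<close>.
\<close>
lemma nn_integral_cball_moment:
  fixes x :: "'a::euclidean_space"
  assumes s: "s > 0"
  shows "(\<integral>\<^sup>+y. ennreal ((x \<bullet> y) ^ (2 * m)) * indicator (cball 0 s) y \<partial>lborel)
    = ennreal (pi powr (real DIM('a) / 2) * fact (2 * m) / fact m * rGamma (real DIM('a) / 2 + real m + 1)
        * s ^ DIM('a) * (s\<^sup>2 * (norm x)\<^sup>2 / 4) ^ m)"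
proof -
  have [measurable]: "(indicator (cball 0 r) :: 'a \<Rightarrow> ennreal) \<in> borel_measurable borel" for r
    by (intro borel_measurable_indicator) simp
  let ?d = "DIM('a)"
  define g where "g = real ?d / 2 + real m"
  define M where "M = (\<integral>\<^sup>+y. ennreal ((x \<bullet> y) ^ (2 * m)) * indicator (cball 0 1) y \<partial>lborel)"
  have g: "g > 0" by (simp add: g_def add_pos_nonneg)
  have "ennreal ((2 * pi) powr (real ?d / 2) * norm x ^ (2 * m) * fact (2 * m) / (2 ^ m * fact m))
      = (\<integral>\<^sup>+y. ennreal ((x \<bullet> y) ^ (2 * m) * exp (- (norm y)\<^sup>2 / 2)) \<partial>lborel)"
    by (rule nn_integral_gauss_moment [symmetric])
  also have "\<dots> = (\<integral>\<^sup>+y. \<integral>\<^sup>+u. ennreal ((x \<bullet> y) ^ (2 * m)) * (ennreal (exp (- u)) * indicator {(norm y)\<^sup>2 / 2..} u) \<partial>lborel \<partial>lborel)"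
  proof (intro nn_integral_cong)
    fix y :: 'a
    have "(\<integral>\<^sup>+u. ennreal ((x \<bullet> y) ^ (2 * m)) * (ennreal (exp (- u)) * indicator {(norm y)\<^sup>2 / 2..} u) \<partial>lborel)
        = ennreal ((x \<bullet> y) ^ (2 * m)) * ennreal (exp (- ((norm y)\<^sup>2 / 2)))"
      by (subst exp_layer_cake) (auto intro!: nn_integral_cmult)
    thus "ennreal ((x \<bullet> y) ^ (2 * m) * exp (- (norm y)\<^sup>2 / 2)) = (\<integral>\<^sup>+u. ennreal ((x \<bullet> y) ^ (2 * m)) * (ennreal (exp (- u)) * indicator {(norm y)\<^sup>2 / 2..} u) \<partial>lborel)"
      by (simp add: ennreal_mult)
  qed
  also have "\<dots> = (\<integral>\<^sup>+y. \<integral>\<^sup>+u. ennreal ((x \<bullet> y) ^ (2 * m)) * (ennreal (exp (- u)) * (if (norm y)\<^sup>2 / 2 \<le> u then 1 else 0)) \<partial>lborel \<partial>lborel)"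
    by (intro nn_integral_cong) (auto simp: indicator_def)
  also have "\<dots> = (\<integral>\<^sup>+u. \<integral>\<^sup>+y. ennreal ((x \<bullet> y) ^ (2 * m)) * (ennreal (exp (- u)) * (if (norm y)\<^sup>2 / 2 \<le> u then 1 else 0)) \<partial>lborel \<partial>lborel)"
    by (rule lborel_pair.Fubini') measurable
  also have "\<dots> = (\<integral>\<^sup>+u. ennreal (indicator {0..} u * u powr (g + 1 - 1) / exp u) * (ennreal (2 powr g) * M) \<partial>lborel)"
  proof (rule nn_integral_cong_AE)
    \<comment> \<open>at \<open>u = 0\<close> the ball degenerates and the scaling law does not apply\<close>
    have "AE u in lborel. u \<noteq> (0::real)"
      by (rule AE_lborel_singleton)
    thus "AE u in lborel. (\<integral>\<^sup>+y. ennreal ((x \<bullet> y) ^ (2 * m)) * (ennreal (exp (- u)) * (if (norm y)\<^sup>2 / 2 \<le> u then 1 else 0)) \<partial>lborel)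
      = ennreal (indicator {0..} u * u powr (g + 1 - 1) / exp u) * (ennreal (2 powr g) * M)"
    proof eventually_elim
      fix u :: real assume u0: "u \<noteq> 0"
      show "(\<integral>\<^sup>+y. ennreal ((x \<bullet> y) ^ (2 * m)) * (ennreal (exp (- u)) * (if (norm y)\<^sup>2 / 2 \<le> u then 1 else 0)) \<partial>lborel)
        = ennreal (indicator {0..} u * u powr (g + 1 - 1) / exp u) * (ennreal (2 powr g) * M)"
      proof (cases "u > 0")
        case True
        have iff: "(norm y)\<^sup>2 / 2 \<le> u \<longleftrightarrow> y \<in> cball 0 (sqrt (2 * u))" for y :: 'a
          using True real_le_rsqrt [of "norm y" "2 * u"] sqrt_le_D [of "2 * u"] real_sqrt_le_iff [of "(norm y)\<^sup>2" "2 * u"] by auto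
        have sq: "sqrt (2 * u) ^ (2 * m + ?d) = 2 powr g * u powr g"
          using True by (simp add: powr_realpow [symmetric] powr_half_sqrt [symmetric] powr_powr powr_mult g_def add_divide_distrib)
            (simp add: add.commute)
        have "(\<integral>\<^sup>+y. ennreal ((x \<bullet> y) ^ (2 * m)) * (ennreal (exp (- u)) * (if (norm y)\<^sup>2 / 2 \<le> u then 1 else 0)) \<partial>lborel)
            = (\<integral>\<^sup>+y. ennreal (exp (- u)) * (ennreal ((x \<bullet> y) ^ (2 * m)) * indicator (cball 0 (sqrt (2 * u))) y) \<partial>lborel)"
          unfolding iff by (intro nn_integral_cong) (auto simp: indicator_def mult_ac)
        also have "\<dots> = ennreal (exp (- u)) * (\<integral>\<^sup>+y. ennreal ((x \<bullet> y) ^ (2 * m)) * indicator (cball 0 (sqrt (2 * u))) y \<partial>lborel)"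
          by (rule nn_integral_cmult) measurable
        also have "\<dots> = ennreal (exp (- u)) * (ennreal (2 powr g * u powr g) * M)"
          using True by (subst nn_integral_cball_scale) (simp_all add: M_def sq)
        also have "\<dots> = ennreal (indicator {0..} u * u powr (g + 1 - 1) / exp u) * (ennreal (2 powr g) * M)"
          using True by (simp add: exp_minus divide_inverse ennreal_mult mult_ac)
        finally show ?thesis .
      next
        case False
        hence "\<not> (norm y)\<^sup>2 / 2 \<le> u" for y :: 'a
          using u0 by (smt (verit) zero_le_power2 divide_nonneg_pos)
        thus ?thesis
          using u0 False by (simp add: indicator_def)
      qed
    qed
  qed
  also have "\<dots> = ennreal (Gamma (g + 1)) * (ennreal (2 powr g) * M)"
    by (subst nn_integral_multc) (use g in \<open>auto simp: Gamma_conv_nn_integral_real\<close>)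
  finally have eq: "ennreal ((2 * pi) powr (real ?d / 2) * norm x ^ (2 * m) * fact (2 * m) / (2 ^ m * fact m))
      = ennreal (Gamma (g + 1)) * (ennreal (2 powr g) * M)" .
  have G: "Gamma (g + 1) > 0"
    using g by (intro Gamma_real_pos) simp
  define c where "c = rGamma (g + 1) * 2 powr (- g)"
  have c0: "c \<ge> 0" and c1: "c * (Gamma (g + 1) * 2 powr g) = 1"
    using G by (auto simp: c_def rGamma_inverse_Gamma powr_minus field_simps)
  have "M = ennreal (c * (Gamma (g + 1) * 2 powr g)) * M"
    unfolding c1 by simp
  also have "\<dots> = ennreal c * (ennreal (Gamma (g + 1)) * (ennreal (2 powr g) * M))"
    using c0 G by (simp add: ennreal_mult mult_ac)
  also have "\<dots> = ennreal (c * ((2 * pi) powr (real ?d / 2) * norm x ^ (2 * m) * fact (2 * m) / (2 ^ m * fact m)))"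
    unfolding eq [symmetric] using c0 by (simp flip: ennreal_mult)
  finally have M: "M = \<dots>" .
  have p: "2 powr (- g) = 2 powr (- (real ?d / 2)) / 2 ^ m" "(2 * pi) powr (real ?d / 2) = 2 powr (real ?d / 2) * pi powr (real ?d / 2)"
    by (simp_all add: g_def powr_diff powr_realpow powr_mult)
  have cancel: "2 powr (real ?d / 2) * (2 powr (- (real ?d / 2)) * t) = t" for t :: real
    by (simp flip: mult.assoc powr_add)
  have four: "(4::real) ^ m = 2 ^ m * 2 ^ m"
    by (simp flip: power_mult_distrib)
  have "s ^ (2 * m + ?d) * (c * ((2 * pi) powr (real ?d / 2) * norm x ^ (2 * m) * fact (2 * m) / (2 ^ m * fact m)))
    = (pi powr (real DIM('a) / 2) * fact (2 * m) / fact m * rGamma (real DIM('a) / 2 + real m + 1)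
        * s ^ DIM('a) * (s\<^sup>2 * (norm x)\<^sup>2 / 4) ^ m)"
    unfolding c_def p
    by (simp add: g_def power_add power_mult power_mult_distrib power_divide mult_ac)
       (simp add: divide_simps, simp add: power2_eq_square power_mult_distrib four cancel)
  thus ?thesis
    unfolding nn_integral_cball_scale [OF s] M_def [symmetric] unfolding M
    using s c0 by (simp flip: ennreal_mult)
qed


section \<open>The Fourier transform of a ball and non-negative definiteness\<close>

text \<open>
  A power series in a bounded function may be integrated termwise against a bounded weight: the norms of the
  terms are dominated by the series of absolute values at the bound.
\<close>
lemma sums_integral_powser:
  fixes a :: "nat \<Rightarrow> real" and g w :: "'a \<Rightarrow> real"
  assumes M: "finite_measure M"
    and [measurable]: "g \<in> borel_measurable M" "w \<in> borel_measurable M"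
    and g: "\<And>x. x \<in> space M \<Longrightarrow> \<bar>g x\<bar> \<le> B"
    and w: "\<And>x. x \<in> space M \<Longrightarrow> \<bar>w x\<bar> \<le> W"
    and a: "\<And>t. summable (\<lambda>m. a m * t ^ m)"
  shows "(\<lambda>m. a m * (LINT x|M. w x * g x ^ m)) sums (LINT x|M. w x * (\<Sum>m. a m * g x ^ m))"
proof -
  interpret finite_measure M by fact
  have nn: "0 \<le> B" "0 \<le> W" if "x \<in> space M" for x
    using g [OF that] w [OF that] by linarith+
  have bd: "\<bar>w x * g x ^ m\<bar> \<le> W * B ^ m" if "x \<in> space M" for x m
    using g [OF that] w [OF that] nn [OF that] by (auto simp: abs_mult power_abs intro!: mult_mono power_mono)
  have int0: "integrable M (\<lambda>x. w x * g x ^ m)" for m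
    by (rule integrable_const_bound [of _ "W * B ^ m"]) (auto intro: bd)
  have sa: "summable (\<lambda>m. \<bar>a m * t ^ m\<bar>)" for t
    using powser_insidea [OF a [of "\<bar>t\<bar> + 1"], of t] by simp
  have int: "integrable M (\<lambda>x. a m * (w x * g x ^ m))" for m
    by (intro integrable_mult_right int0)
  have le: "(LINT x|M. norm (a m * (w x * g x ^ m))) \<le> \<bar>a m * B ^ m\<bar> * (\<bar>W\<bar> * measure M (space M))" for m
  proof -
    have "(LINT x|M. norm (a m * (w x * g x ^ m))) \<le> (LINT x|M. \<bar>a m * B ^ m\<bar> * \<bar>W\<bar>)"
    proof (rule integral_mono)
      fix x assume "x \<in> space M"
      hence "\<bar>w x * g x ^ m\<bar> \<le> \<bar>W * B ^ m\<bar>"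
        using bd [of x m] by linarith
      from mult_left_mono [OF this, of "\<bar>a m\<bar>"]
      show "norm (a m * (w x * g x ^ m)) \<le> \<bar>a m * B ^ m\<bar> * \<bar>W\<bar>"
        by (simp add: abs_mult mult_ac)
    qed (use int in auto)
    thus ?thesis by (simp add: mult_ac)
  qed
  have summ: "summable (\<lambda>m. LINT x|M. norm (a m * (w x * g x ^ m)))"
    by (rule summable_comparison_test' [OF summable_mult2 [OF sa [of B]], of 0])
       (use le in \<open>auto simp: integral_nonneg_AE\<close>)
  have "(\<lambda>m. LINT x|M. a m * (w x * g x ^ m)) sums (LINT x|M. (\<Sum>m. a m * (w x * g x ^ m)))"
  proof (rule sums_integral [OF int _ summ])
    show "AE x in M. summable (\<lambda>m. norm (a m * (w x * g x ^ m)))"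
    proof (rule AE_I2)
      fix x
      show "summable (\<lambda>m. norm (a m * (w x * g x ^ m)))"
        using summable_mult [OF sa [of "g x"], of "\<bar>w x\<bar>"] by (simp add: abs_mult mult_ac)
    qed
  qed
  moreover have "(\<Sum>m. a m * (w x * g x ^ m)) = w x * (\<Sum>m. a m * g x ^ m)" for x
    using suminf_mult [OF a [of "g x"], of "w x"] by (simp add: mult_ac)
  ultimately show ?thesis
    by simp
qed

text \<open>
  Expand \<open>cos(x \<bullet> y)\<close> as a power series in \<open>(x \<bullet> y)\<^sup>2\<close> and insert the moments of the ball: the factors \<open>(2m)!\<close>
  cancel, and the series of \<open>\<phi>\<close> of order \<open>d/2\<close> appears.
\<close>
lemma integral_cball_cos:
  fixes x :: "'a::euclidean_space"
  assumes s: "s > 0"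
  shows "(LINT y:cball 0 s|lborel. cos (x \<bullet> y)) = pi powr (real DIM('a) / 2)
    * (s ^ DIM('a) * bessel_clifford (real DIM('a) / 2) (s\<^sup>2 * ((norm x)\<^sup>2 / 4)))"
proof -
  let ?d = "DIM('a)"
  define M :: "'a measure" where "M = restrict_space lborel (cball 0 s)"
  define a :: "nat \<Rightarrow> real" where "a = (\<lambda>m. (-1) ^ m / fact (2 * m))"
  have spM: "space M = cball 0 s"
    by (simp add: M_def space_restrict_space)
  have fin: "finite_measure M"
    by standard (simp add: M_def emeasure_restrict_space space_restrict_space emeasure_cball s less_imp_le)
  have meas: "(\<lambda>y. (x \<bullet> y)\<^sup>2) \<in> borel_measurable M"
    unfolding M_def by (intro measurable_restrict_space1) simp
  have bound: "\<bar>(x \<bullet> y)\<^sup>2\<bar> \<le> (norm x * s)\<^sup>2" if "y \<in> space M" for y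
  proof -
    have "\<bar>x \<bullet> y\<bar> \<le> norm x * norm y"
      by (rule Cauchy_Schwarz_ineq2)
    also have "\<dots> \<le> norm x * s"
      using that by (intro mult_left_mono) (auto simp: spM)
    finally show ?thesis
      using s by (simp add: abs_le_square_iff [symmetric] abs_mult)
  qed
  have cos_eq: "(\<lambda>m. a m * (t\<^sup>2) ^ m) sums cos t" for t
    using cos_paired [of t] by (simp add: a_def power_mult)
  have summ: "summable (\<lambda>m. a m * t ^ m)" for t
    by (rule powser_inside [of a "\<bar>t\<bar> + 1"])
       (use sums_summable [OF cos_eq [of "sqrt (\<bar>t\<bar> + 1)"]] in auto)
  have moment: "(LINT y|M. ((x \<bullet> y)\<^sup>2) ^ m)
      = pi powr (real ?d / 2) * fact (2 * m) / fact m * rGamma (real ?d / 2 + real m + 1)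
        * s ^ ?d * (s\<^sup>2 * (norm x)\<^sup>2 / 4) ^ m" for m
  proof (rule integral_eq_nn_integral [THEN trans])
    have "(\<integral>\<^sup>+y. ennreal (((x \<bullet> y)\<^sup>2) ^ m) \<partial>M)
        = (\<integral>\<^sup>+y. ennreal ((x \<bullet> y) ^ (2 * m)) * indicator (cball 0 s) y \<partial>lborel)"
      unfolding M_def by (subst nn_integral_restrict_space) (auto simp: power_mult)
    moreover have "rGamma (real ?d / 2 + real m + 1) \<ge> 0"
      using Gamma_real_pos [of "real ?d / 2 + real m + 1"]
      by (simp add: rGamma_inverse_Gamma add_nonneg_pos less_imp_le)
    ultimately show "enn2real (\<integral>\<^sup>+y. ennreal (((x \<bullet> y)\<^sup>2) ^ m) \<partial>M)
      = pi powr (real ?d / 2) * fact (2 * m) / fact m * rGamma (real ?d / 2 + real m + 1)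
        * s ^ ?d * (s\<^sup>2 * (norm x)\<^sup>2 / 4) ^ m"
      using s by (simp add: nn_integral_cball_moment)
  qed (use meas in auto)
  have "(\<lambda>m. a m * (LINT y|M. 1 * ((x \<bullet> y)\<^sup>2) ^ m)) sums (LINT y|M. 1 * (\<Sum>m. a m * ((x \<bullet> y)\<^sup>2) ^ m))"
    by (rule sums_integral_powser [OF fin meas _ bound _ summ, where W = 1]) auto
  hence "(\<lambda>m. a m * (LINT y|M. ((x \<bullet> y)\<^sup>2) ^ m)) sums (LINT y|M. cos (x \<bullet> y))"
    using sums_unique [OF cos_eq] by simp
  moreover have "a m * (LINT y|M. ((x \<bullet> y)\<^sup>2) ^ m) = pi powr (real ?d / 2) * s ^ ?d
      * (bessel_clifford_coeff (real ?d / 2) m * (s\<^sup>2 * ((norm x)\<^sup>2 / 4)) ^ m)" for m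
    unfolding moment a_def bessel_clifford_coeff_def by simp
  ultimately have "(\<lambda>m. pi powr (real ?d / 2) * s ^ ?d
      * (bessel_clifford_coeff (real ?d / 2) m * (s\<^sup>2 * ((norm x)\<^sup>2 / 4)) ^ m)) sums (LINT y|M. cos (x \<bullet> y))"
    by simp
  moreover have "(\<lambda>m. pi powr (real ?d / 2) * s ^ ?d
      * (bessel_clifford_coeff (real ?d / 2) m * (s\<^sup>2 * ((norm x)\<^sup>2 / 4)) ^ m)) sums
      (pi powr (real ?d / 2) * s ^ ?d * bessel_clifford (real ?d / 2) (s\<^sup>2 * ((norm x)\<^sup>2 / 4)))"
    unfolding bessel_clifford_def by (intro sums_mult summable_sums summable_bessel_clifford)
  ultimately have "(LINT y|M. cos (x \<bullet> y))
      = pi powr (real ?d / 2) * s ^ ?d * bessel_clifford (real ?d / 2) (s\<^sup>2 * ((norm x)\<^sup>2 / 4))"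
    by (rule sums_unique2)
  thus ?thesis
    unfolding M_def by (subst (asm) integral_restrict_space) (auto simp: set_lebesgue_integral_def mult_ac)
qed

text \<open>
  Let \<open>D(s)\<close> be the quadratic form of \<open>s\<^sup>d \<phi>\<^sub>\<nu>\<^sub>+\<^sub>1(s\<^sup>2 \<bar>x\<bar>\<^sup>2 / 4)\<close>. Up to a positive factor it is the integral over the
  ball of radius \<open>s\<close> of the non-negative trigonometric polynomial \<open>Q(w) = \<bar>\<Sum> a\<^sub>x exp(i x \<bullet> w)\<bar>\<^sup>2\<close>, so it increases
  with \<open>s\<close>. Its derivative at \<open>s = k\<close> is \<open>2 k\<^sup>d\<^sup>-\<^sup>1\<close> times the quadratic form of \<open>\<phi>\<^sub>\<nu>(k\<^sup>2 \<bar>x\<bar>\<^sup>2 / 4)\<close>.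
\<close>
lemma nonneg_definite_bessel_clifford:
  assumes d: "real DIM('a) = 2 * \<nu> + 2" and k: "k > 0"
  shows "nonneg_definite (\<lambda>x::'a::euclidean_space. bessel_clifford \<nu> (k\<^sup>2 * ((norm x)\<^sup>2 / 4)))"
  unfolding nonneg_definite_def
proof (intro allI impI)
  fix S :: "'a set" and a :: "'a \<Rightarrow> real"
  assume S: "finite S"
  let ?d = "DIM('a)"
  let ?v = "\<lambda>x y :: 'a. (norm (x - y))\<^sup>2 / 4"
  define D where "D = (\<lambda>s. \<Sum>x\<in>S. \<Sum>y\<in>S. a x * a y * (s ^ ?d * bessel_clifford (\<nu> + 1) (s\<^sup>2 * ?v x y)))"
  define Q where "Q = (\<lambda>w. (\<Sum>x\<in>S. a x * cos (x \<bullet> w))\<^sup>2 + (\<Sum>x\<in>S. a x * sin (x \<bullet> w))\<^sup>2)"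
  have Q: "Q w = (\<Sum>x\<in>S. \<Sum>y\<in>S. a x * a y * cos ((x - y) \<bullet> w))" for w
    unfolding Q_def power2_eq_square sum_product
    by (simp add: inner_diff_left cos_diff sum.distrib [symmetric] algebra_simps)
  have cont: "continuous_on UNIV Q"
    unfolding Q_def by (intro continuous_intros)
  have int: "set_integrable lborel (cball 0 s) f" if "continuous_on UNIV f" for s and f :: "'a \<Rightarrow> real"
    using borel_integrable_compact [OF compact_cball continuous_on_subset [OF that subset_UNIV]]
    by (simp add: set_integrable_def indicator_scaleR_eq_if)
  have half: "real ?d / 2 = \<nu> + 1"
    using d by simp
  have DQ: "pi powr (\<nu> + 1) * D s = (LINT w:cball 0 s|lborel. Q w)" if s: "s > 0" for s
  proof -
    have "(LINT w:cball 0 s|lborel. Q w) = (\<Sum>x\<in>S. \<Sum>y\<in>S. a x * a y * (LINT w:cball 0 s|lborel. cos ((x - y) \<bullet> w)))"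
    proof -
      have "(LINT w:cball 0 s|lborel. Q w) = (\<Sum>x\<in>S. \<Sum>y\<in>S. (LINT w:cball 0 s|lborel. a x * a y * cos ((x - y) \<bullet> w)))"
      proof -
        have i: "integrable lborel (\<lambda>w. indicator (cball 0 s) w *\<^sub>R (a x * a y * cos ((x - y) \<bullet> w)))" for x y
        proof -
          have "continuous_on UNIV (\<lambda>w. a x * a y * cos ((x - y) \<bullet> w))"
            by (intro continuous_intros)
          from int [OF this] show ?thesis
            unfolding set_integrable_def .
        qed
        show ?thesis
          unfolding set_lebesgue_integral_def Q scaleR_sum_right
          by (subst Bochner_Integration.integral_sum, intro Bochner_Integration.integrable_sum i)
             (intro sum.cong refl Bochner_Integration.integral_sum i)
      qed
      thus ?thesis by simp
    qed
    also have "\<dots> = pi powr (\<nu> + 1) * D s"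
      unfolding integral_cball_cos [OF s] half D_def sum_distrib_left by (simp add: mult_ac)
    finally show ?thesis ..
  qed
  have mono: "mono_on {0<..} D"
  proof (rule mono_onI)
    fix s t :: real assume st: "s \<in> {0<..}" "t \<in> {0<..}" "s \<le> t"
    have "(LINT w:cball 0 s|lborel. Q w) \<le> (LINT w:cball 0 t|lborel. Q w)"
      unfolding set_lebesgue_integral_def
      by (rule integral_mono) (use int [OF cont] st in \<open>auto simp: set_integrable_def indicator_def Q_def\<close>)
    hence "pi powr (\<nu> + 1) * D s \<le> pi powr (\<nu> + 1) * D t"
      using st by (simp add: DQ)
    thus "D s \<le> D t"
      by (simp add: mult_le_cancel_left_pos)
  qed
  define E where "E = (\<Sum>x\<in>S. \<Sum>y\<in>S. a x * a y * bessel_clifford \<nu> (k\<^sup>2 * ?v x y))"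
  have "(D has_real_derivative (\<Sum>x\<in>S. \<Sum>y\<in>S. a x * a y * (2 * (k ^ (?d - 1) * bessel_clifford \<nu> (k\<^sup>2 * ?v x y))))) (at k)"
    unfolding D_def by (intro DERIV_sum DERIV_cmult DERIV_power_bessel_clifford d) (simp add: Suc_leI)
  hence "(\<Sum>x\<in>S. \<Sum>y\<in>S. a x * a y * (2 * (k ^ (?d - 1) * bessel_clifford \<nu> (k\<^sup>2 * ?v x y)))) \<ge> 0"
    using mono_on_imp_deriv_nonneg [OF mono] k by (simp add: interior_open)
  also have "(\<Sum>x\<in>S. \<Sum>y\<in>S. a x * a y * (2 * (k ^ (?d - 1) * bessel_clifford \<nu> (k\<^sup>2 * ?v x y)))) = 2 * k ^ (?d - 1) * E"
    unfolding E_def sum_distrib_left by (simp add: mult_ac)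
  finally have "0 \<le> 2 * k ^ (?d - 1) * E" .
  moreover have "0 < 2 * k ^ (?d - 1)"
    using k by simp
  ultimately have "0 \<le> E"
    by (metis mult_pos_neg not_le)
  thus "(\<Sum>x\<in>S. \<Sum>y\<in>S. a x * a y * bessel_clifford \<nu> (k\<^sup>2 * ((norm (x - y))\<^sup>2 / 4))) \<ge> 0"
    unfolding E_def .
qed


section \<open>Superpositions of Bessel kernels over a band of frequencies\<close>

text \<open>
  The inverse Fourier transform of the radial spectrum \<open>p\<close>, cut off at \<open>K\<close>, up to a constant factor and as a
  function of the squared distance \<open>u\<close>; in this variable it is entire.
\<close>
definition band_integral :: "nat \<Rightarrow> (real \<Rightarrow> real) \<Rightarrow> real \<Rightarrow> real \<Rightarrow> real" where
  "band_integral d p K u =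
     integral {0..K} (\<lambda>k. k ^ (d - 1) * p k * bessel_clifford (real d / 2 - 1) (k\<^sup>2 * (u / 4)))"

text \<open>Termwise integration of the series of \<open>\<phi>\<close>, for a fixed \<open>u\<close>, with \<open>k\<^sup>2 u / 4\<close> as the bounded function.\<close>
lemma band_integral_powser:
  assumes p: "continuous_on {0..K} p"
  obtains b where "\<And>t. summable (\<lambda>m. b m * t ^ m)" "\<And>u. band_integral d p K u = (\<Sum>m. b m * u ^ m)"
proof -
  define M :: "real measure" where "M = restrict_space lborel {0..K}"
  define w where "w = (\<lambda>k. k ^ (d - 1) * p k)"
  define a where "a = bessel_clifford_coeff (real d / 2 - 1)"
  define b where "b = (\<lambda>m. a m * (LINT k|M. w k * (k\<^sup>2 / 4) ^ m))"
  have spM: "space M = {0..K}"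
    by (simp add: M_def space_restrict_space)
  have fin: "finite_measure M"
    by standard (simp add: M_def emeasure_restrict_space space_restrict_space emeasure_lborel_Icc_eq)
  have cw: "continuous_on {0..K} w"
    unfolding w_def by (intro continuous_intros p)
  have wM: "w \<in> borel_measurable M"
  proof -
    have "sets M = sets (restrict_space borel {0..K})"
      by (simp add: M_def sets_restrict_space)
    hence "(borel_measurable M :: (real \<Rightarrow> real) set) = borel_measurable (restrict_space borel {0..K})"
      by (rule measurable_cong_sets) (rule refl)
    thus ?thesis
      using borel_measurable_continuous_on_restrict [OF cw] by simp
  qed
  obtain W where "\<forall>y\<in>w ` {0..K}. norm y \<le> W"
    using compact_imp_bounded [OF compact_continuous_image [OF cw compact_Icc]]
    unfolding bounded_iff by blast
  hence W: "\<bar>w k\<bar> \<le> W" if "k \<in> space M" for k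
    using that by (simp add: spM)
  have gM: "(\<lambda>k. k\<^sup>2 * (u / 4)) \<in> borel_measurable M" for u
    unfolding M_def by (intro measurable_restrict_space1) simp
  have gB: "\<bar>k\<^sup>2 * (u / 4)\<bar> \<le> K\<^sup>2 * \<bar>u / 4\<bar>" if "k \<in> space M" for k u
    using that by (auto simp: spM abs_mult intro!: mult_right_mono power_mono)
  have sa: "summable (\<lambda>m. a m * t ^ m)" for t
    unfolding a_def by (rule summable_bessel_clifford)
  have b: "a m * (LINT k|M. w k * (k\<^sup>2 * (u / 4)) ^ m) = b m * u ^ m" for m u
  proof -
    have "w k * (k\<^sup>2 * (u / 4)) ^ m = u ^ m * (w k * (k\<^sup>2 / 4) ^ m)" for k
    proof -
      have "k\<^sup>2 * (u / 4) = u * (k\<^sup>2 / 4)" by simp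
      thus ?thesis by (simp only: power_mult_distrib) (simp only: mult_ac)
    qed
    hence "(\<lambda>k. w k * (k\<^sup>2 * (u / 4)) ^ m) = (\<lambda>k. u ^ m * (w k * (k\<^sup>2 / 4) ^ m))"
      by (rule ext)
    thus ?thesis
      unfolding b_def by (simp only:) simp
  qed
  have sums: "(\<lambda>m. b m * u ^ m) sums (LINT k|M. w k * (\<Sum>m. a m * (k\<^sup>2 * (u / 4)) ^ m))" for u
    using sums_integral_powser [OF fin gM wM gB W sa] by (simp only: b)
  have "band_integral d p K u = (\<Sum>m. b m * u ^ m)" for u
  proof -
    have "continuous_on {0..K} (\<lambda>k. w k * bessel_clifford (real d / 2 - 1) (k\<^sup>2 * (u / 4)))"
      by (intro continuous_intros cw)
    hence "set_integrable lborel {0..K} (\<lambda>k. w k * bessel_clifford (real d / 2 - 1) (k\<^sup>2 * (u / 4)))"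
      by (rule borel_integrable_atLeastAtMost')
    hence "band_integral d p K u = (LINT k:{0..K}|lborel. w k * bessel_clifford (real d / 2 - 1) (k\<^sup>2 * (u / 4)))"
      unfolding band_integral_def w_def by (simp add: set_borel_integral_eq_integral)
    also have "\<dots> = (LINT k|M. w k * (\<Sum>m. a m * (k\<^sup>2 * (u / 4)) ^ m))"
      unfolding M_def bessel_clifford_def a_def
      by (subst integral_restrict_space) (auto simp: set_lebesgue_integral_def)
    also have "\<dots> = (\<Sum>m. b m * u ^ m)"
      by (rule sums_unique [OF sums])
    finally show ?thesis .
  qed
  with sums_summable [OF sums] show ?thesis
    by (rule that)
qed

lemma nonneg_definite_band_integral:
  assumes p: "continuous_on {0..K} p" "\<And>k. k \<in> {0..K} \<Longrightarrow> p k \<ge> 0" and d: "DIM('a) \<ge> 2"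
  shows "nonneg_definite (\<lambda>x::'a::euclidean_space. band_integral DIM('a) p K ((norm x)\<^sup>2))"
  unfolding nonneg_definite_def
proof (intro allI impI)
  fix S :: "'a set" and a :: "'a \<Rightarrow> real"
  assume S: "finite S"
  let ?d = "DIM('a)"
  let ?f = "\<lambda>x y k. k ^ (?d - 1) * p k * bessel_clifford (real ?d / 2 - 1) (k\<^sup>2 * ((norm (x - y))\<^sup>2 / 4))"
  have int: "?f x y integrable_on {0..K}" for x y :: 'a
    by (intro integrable_continuous_interval continuous_intros p)
  have "(\<Sum>x\<in>S. \<Sum>y\<in>S. a x * a y * band_integral ?d p K ((norm (x - y))\<^sup>2))
      = integral {0..K} (\<lambda>k. \<Sum>x\<in>S. \<Sum>y\<in>S. a x * a y * ?f x y k)"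
    (is "_ = integral _ (\<lambda>k. \<Sum>x\<in>S. \<Sum>y\<in>S. ?h x y k)")
  proof -
    have h: "?h x y integrable_on {0..K}" for x y
      by (intro integrable_on_mult_right int)
    have "integral {0..K} (\<lambda>k. \<Sum>x\<in>S. \<Sum>y\<in>S. ?h x y k) = (\<Sum>x\<in>S. \<Sum>y\<in>S. integral {0..K} (?h x y))"
      by (subst integral_sum [OF S]) (intro integrable_sum S h sum.cong refl integral_sum)+
    thus ?thesis
      by (simp add: band_integral_def)
  qed
  also have "\<dots> \<ge> 0"
  proof (rule integral_nonneg)
    show "(\<lambda>k. \<Sum>x\<in>S. \<Sum>y\<in>S. a x * a y * ?f x y k) integrable_on {0..K}"
      by (intro integrable_sum S integrable_on_mult_right int)
    fix k assume k: "k \<in> {0..K}"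
    show "0 \<le> (\<Sum>x\<in>S. \<Sum>y\<in>S. a x * a y * ?f x y k)"
    proof (cases "k = 0")
      case True
      have z: "(0::real) ^ (?d - 1) = 0"
        using d by (intro zero_power) simp
      show ?thesis
        by (simp only: True z mult_zero_left mult_zero_right sum.neutral_const order_refl)
    next
      case False
      hence k0: "k > 0" using k by simp
      have "real ?d = 2 * (real ?d / 2 - 1) + 2" by simp
      from nonneg_definite_bessel_clifford [OF this k0]
      have "0 \<le> (\<Sum>x\<in>S. \<Sum>y\<in>S. a x * a y * bessel_clifford (real ?d / 2 - 1) (k\<^sup>2 * ((norm (x - y))\<^sup>2 / 4)))"
        using S by (simp only: nonneg_definite_def)
      hence "0 \<le> k ^ (?d - 1) * p k * (\<Sum>x\<in>S. \<Sum>y\<in>S. a x * a y * bessel_clifford (real ?d / 2 - 1) (k\<^sup>2 * ((norm (x - y))\<^sup>2 / 4)))"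
        using k0 p(2) [OF k] by simp
      thus ?thesis
        by (simp add: sum_distrib_left mult_ac)
    qed
  qed
  finally show "(\<Sum>x\<in>S. \<Sum>y\<in>S. a x * a y * band_integral ?d p K ((norm (x - y))\<^sup>2)) \<ge> 0" .
qed


section \<open>Smoothness of power series in the squared norm\<close>

text \<open>
  Introduction with an arbitrary derivative \<open>f'\<close> in place of the chosen \<open>frechet_derivative\<close>, so that the
  differentiation rules can be used directly.
\<close>
lemma times_cont_diff_SucI:
  assumes "\<And>x. (f has_derivative f' x) (at x)"
    and "\<And>v. times_cont_diff n (\<lambda>x. f' x v)"
  shows "times_cont_diff (Suc n) f"
proof -
  have "frechet_derivative f (at x) = f' x" for x
    using frechet_derivative_at [OF assms(1)] by simp
  thus ?thesis
    using assms by (auto simp: differentiable_def)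
qed

lemma times_cont_diff_SucD:
  assumes "times_cont_diff (Suc n) f"
  shows "(f has_derivative frechet_derivative f (at x)) (at x)"
    and "times_cont_diff n (\<lambda>x. frechet_derivative f (at x) v)"
  using assms by (auto simp: frechet_derivative_works)

lemma times_cont_diff_less: "times_cont_diff (Suc n) f \<Longrightarrow> times_cont_diff n f"
proof (induction n arbitrary: f)
  case 0
  thus ?case
    by (auto intro!: continuous_at_imp_continuous_on differentiable_imp_continuous_within)
next
  case (Suc n)
  show ?case
    by (rule times_cont_diff_SucI [OF times_cont_diff_SucD(1) [OF Suc.prems]])
       (rule Suc.IH [OF times_cont_diff_SucD(2) [OF Suc.prems]])
qed

lemma times_cont_diff_const: "times_cont_diff n (\<lambda>x. c)"
  by (induction n arbitrary: c) (auto intro!: times_cont_diff_SucI derivative_eq_intros simp del: times_cont_diff.simps(2))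

lemma times_cont_diff_bounded_linear: "bounded_linear f \<Longrightarrow> times_cont_diff n f"
  by (cases n) (auto intro!: times_cont_diff_SucI bounded_linear_imp_has_derivative times_cont_diff_const
      linear_continuous_on simp del: times_cont_diff.simps(2))

lemma times_cont_diff_add:
  "times_cont_diff n f \<Longrightarrow> times_cont_diff n g \<Longrightarrow> times_cont_diff n (\<lambda>x. f x + g x)"
proof (induction n arbitrary: f g)
  case 0
  thus ?case by (auto intro: continuous_intros)
next
  case (Suc n)
  show ?case
    by (rule times_cont_diff_SucI [OF has_derivative_add [OF Suc.prems [THEN times_cont_diff_SucD(1)]]])
       (intro Suc.IH Suc.prems [THEN times_cont_diff_SucD(2)])
qed

lemma times_cont_diff_mult:
  fixes f g :: "'a::real_normed_vector \<Rightarrow> real"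
  shows "times_cont_diff n f \<Longrightarrow> times_cont_diff n g \<Longrightarrow> times_cont_diff n (\<lambda>x. f x * g x)"
proof (induction n arbitrary: f g)
  case 0
  thus ?case by (auto intro: continuous_intros)
next
  case (Suc n)
  show ?case
    by (rule times_cont_diff_SucI [OF has_derivative_mult [OF Suc.prems [THEN times_cont_diff_SucD(1)]]])
       (intro times_cont_diff_add Suc.IH Suc.prems [THEN times_cont_diff_SucD(2)]
          Suc.prems [THEN times_cont_diff_less])
qed

text \<open>
  The derivative in direction \<open>v\<close> is a function of the same kind, with the coefficients \<open>diffs a\<close>, times the linear
  function \<open>2 (x \<bullet> v)\<close>; hence the induction runs over all coefficient sequences at once.
\<close>
lemma times_cont_diff_powser_inner:
  fixes a :: "nat \<Rightarrow> real"
  assumes "\<And>t. summable (\<lambda>m. a m * t ^ m)"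
  shows "times_cont_diff n (\<lambda>x::'a::real_inner. \<Sum>m. a m * (x \<bullet> x) ^ m)"
  using assms
proof (induction n arbitrary: a)
  case 0
  have "isCont (\<lambda>t. \<Sum>m. a m * t ^ m) t" for t
    by (rule DERIV_isCont [OF termdiffs_strong_converges_everywhere]) (rule 0)
  hence c: "continuous_on UNIV (\<lambda>t. \<Sum>m. a m * t ^ m)"
    by (simp add: continuous_at_imp_continuous_on)
  have "continuous_on UNIV (\<lambda>x::'a. x \<bullet> x)"
    by (intro continuous_on_inner continuous_on_id)
  from continuous_on_compose2 [OF c this] show ?case
    by simp
next
  case (Suc n)
  show ?case
  proof (rule times_cont_diff_SucI)
    fix x :: 'a
    have "((\<lambda>t. \<Sum>m. a m * t ^ m) has_derivative (*) (\<Sum>m. diffs a m * (x \<bullet> x) ^ m)) (at (x \<bullet> x))"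
      using termdiffs_strong_converges_everywhere [OF Suc.prems] by (simp add: has_field_derivative_def)
    moreover have "((\<lambda>x::'a. x \<bullet> x) has_derivative (\<lambda>v. 2 * (x \<bullet> v))) (at x)"
      by (auto intro!: derivative_eq_intros simp: inner_commute)
    ultimately show "((\<lambda>x::'a. \<Sum>m. a m * (x \<bullet> x) ^ m) has_derivative
        (\<lambda>v. (\<Sum>m. diffs a m * (x \<bullet> x) ^ m) * (2 * (x \<bullet> v)))) (at x)"
      by (rule has_derivative_compose [rotated])
  next
    fix v :: 'a
    show "times_cont_diff n (\<lambda>x. (\<Sum>m. diffs a m * (x \<bullet> x) ^ m) * (2 * (x \<bullet> v)))"
      by (intro times_cont_diff_mult times_cont_diff_const Suc.IH termdiff_converges_all Suc.prems
          times_cont_diff_bounded_linear bounded_linear_inner_left)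
  qed
qed


section \<open>The Bessel-Lommel covariance\<close>

definition bl_spectrum :: "nat \<Rightarrow> real \<Rightarrow> real \<Rightarrow> real \<Rightarrow> real \<Rightarrow> real" where
  "bl_spectrum d \<eta>\<^sub>0 \<eta>\<^sub>1 \<xi> k =
     1 / (\<eta>\<^sub>0 * \<xi> ^ d) + \<eta>\<^sub>1 * \<xi>\<^sup>2 / (\<eta>\<^sub>0 * \<xi> ^ d) * k\<^sup>2 + \<xi> ^ 4 / (\<eta>\<^sub>0 * \<xi> ^ d) * k ^ 4"

lemma continuous_on_bl_spectrum: "continuous_on A (bl_spectrum d \<eta>\<^sub>0 \<eta>\<^sub>1 \<xi>)"
  unfolding bl_spectrum_def by (intro continuous_intros)

text \<open>With \<open>u = (\<xi> k)\<^sup>2\<close> it is a positive multiple of \<open>1 + \<eta>\<^sub>1 u + u\<^sup>2 = (1 - u)\<^sup>2 + (\<eta>\<^sub>1 + 2) u\<close>.\<close>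
lemma bl_spectrum_nonneg:
  assumes "\<eta>\<^sub>0 > 0" "\<xi> > 0" "\<eta>\<^sub>1 > -2"
  shows "bl_spectrum d \<eta>\<^sub>0 \<eta>\<^sub>1 \<xi> k \<ge> 0"
proof -
  let ?u = "(\<xi> * k)\<^sup>2"
  have "0 \<le> (\<eta>\<^sub>1 + 2) * ?u"
    by (rule mult_nonneg_nonneg) (use assms in auto)
  hence "0 \<le> (1 - ?u)\<^sup>2 + (\<eta>\<^sub>1 + 2) * ?u"
    by (intro add_nonneg_nonneg) auto
  hence "0 \<le> (1 + \<eta>\<^sub>1 * ?u + ?u\<^sup>2) / (\<eta>\<^sub>0 * \<xi> ^ d)"
    using assms by (intro divide_nonneg_pos) (auto simp: power2_eq_square algebra_simps)
  also have "\<dots> = bl_spectrum d \<eta>\<^sub>0 \<eta>\<^sub>1 \<xi> k"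
    by (simp add: bl_spectrum_def add_divide_distrib power_mult_distrib)
  finally show ?thesis .
qed

text \<open>
  The powers of \<open>r\<close> cancel: \<open>r \<cdot> r\<^sup>-\<^sup>d\<^sup>/\<^sup>2 \<cdot> r\<^sup>\<nu> = 1\<close> because \<open>\<nu> = d/2 - 1\<close>. For \<open>d \<ge> 2\<close> both integrands vanish at
  \<open>k = 0\<close>.
\<close>
lemma bl_profile_eq:
  assumes d: "d \<ge> 2" and r: "r > 0"
  shows "bl_profile d \<eta>\<^sub>0 \<eta>\<^sub>1 \<xi> K r = (2 * pi) powr (- real d / 2) * 2 powr (1 - real d / 2)
    * band_integral d (bl_spectrum d \<eta>\<^sub>0 \<eta>\<^sub>1 \<xi>) K (r\<^sup>2)"
proof -
  let ?\<nu> = "real d / 2 - 1"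
  have eq: "k powr (real d / 2) * bessel_J ?\<nu> (k * r) * q
      = (r / 2) powr ?\<nu> * (k ^ (d - 1) * q * bessel_clifford ?\<nu> (k\<^sup>2 * (r\<^sup>2 / 4)))"
    if "k \<ge> 0" for k q
  proof (cases "k = 0")
    case False
    hence k: "k > 0" using that by simp
    have "k powr (real d / 2) * k powr ?\<nu> = k powr (real (d - 1))"
      using d by (simp flip: powr_add)
    hence e: "k powr (real d / 2) * (k powr ?\<nu> * t) = k ^ (d - 1) * t" for t
      using k by (simp add: powr_realpow flip: mult.assoc)
    have "(k * r / 2) powr ?\<nu> = k powr ?\<nu> * (r / 2) powr ?\<nu>"
      using k r by (simp flip: powr_mult)
    moreover have "(k * r)\<^sup>2 / 4 = k\<^sup>2 * (r\<^sup>2 / 4)"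
      by (simp add: power_mult_distrib)
    ultimately have "bessel_J ?\<nu> (k * r) = k powr ?\<nu> * (r / 2) powr ?\<nu> * bessel_clifford ?\<nu> (k\<^sup>2 * (r\<^sup>2 / 4))"
      using k r by (simp add: bessel_J_conv_bessel_clifford)
    thus ?thesis
      by (simp only: mult.assoc e) (simp only: mult_ac)
  qed (use d in simp)
  have rp: "r powr (real d / 2) = r * r powr ?\<nu>"
    using r by (simp add: powr_mult_base)
  have "2 powr (1 - real d / 2) = 1 / 2 powr ?\<nu>"
    using powr_minus_divide [of 2 ?\<nu>] by simp
  moreover have "(2 * pi) powr (- real d / 2) = 1 / (2 * pi) powr (real d / 2)"
    using powr_minus_divide [of "2 * pi" "real d / 2"] by simp
  moreover have "(2 * pi * r) powr (real d / 2) = (2 * pi) powr (real d / 2) * (r * r powr ?\<nu>)"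
    using r by (simp only: powr_mult rp)
  moreover have "(r / 2) powr ?\<nu> = r powr ?\<nu> / 2 powr ?\<nu>"
    using r by (simp add: powr_divide)
  ultimately have const: "r / (2 * pi * r) powr (real d / 2) * (r / 2) powr ?\<nu>
      = (2 * pi) powr (- real d / 2) * 2 powr (1 - real d / 2)"
    using r by simp
  have "bl_profile d \<eta>\<^sub>0 \<eta>\<^sub>1 \<xi> K r = r / (2 * pi * r) powr (real d / 2) *
      integral {0..K} (\<lambda>k. k powr (real d / 2) * bessel_J ?\<nu> (k * r) * bl_spectrum d \<eta>\<^sub>0 \<eta>\<^sub>1 \<xi> k)"
    by (simp add: bl_profile_def bl_spectrum_def Let_def)
  also have "integral {0..K} (\<lambda>k. k powr (real d / 2) * bessel_J ?\<nu> (k * r) * bl_spectrum d \<eta>\<^sub>0 \<eta>\<^sub>1 \<xi> k)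
      = integral {0..K} (\<lambda>k. (r / 2) powr ?\<nu> * (k ^ (d - 1) * bl_spectrum d \<eta>\<^sub>0 \<eta>\<^sub>1 \<xi> k * bessel_clifford ?\<nu> (k\<^sup>2 * (r\<^sup>2 / 4))))"
    by (intro integral_cong eq) simp
  also have "\<dots> = (r / 2) powr ?\<nu> * band_integral d (bl_spectrum d \<eta>\<^sub>0 \<eta>\<^sub>1 \<xi>) K (r\<^sup>2)"
    by (simp add: band_integral_def)
  finally show ?thesis
    by (simp only: mult.assoc [symmetric] const)
qed

text \<open>At the origin, continuity of the power series identifies the limit in the definition of the covariance.\<close>
lemma bl_cov_eq:
  fixes x :: "real ^ 'n"
  assumes d: "CARD('n) \<ge> 2"
  shows "bl_cov \<eta>\<^sub>0 \<eta>\<^sub>1 \<xi> K x = (2 * pi) powr (- real CARD('n) / 2) * 2 powr (1 - real CARD('n) / 2)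
    * band_integral CARD('n) (bl_spectrum CARD('n) \<eta>\<^sub>0 \<eta>\<^sub>1 \<xi>) K ((norm x)\<^sup>2)"
proof (cases "x = 0")
  case False
  thus ?thesis using d by (simp add: bl_cov_def bl_profile_eq)
next
  case True
  let ?d = "CARD('n)"
  let ?A = "(2 * pi) powr (- real ?d / 2) * 2 powr (1 - real ?d / 2)"
  let ?q = "band_integral ?d (bl_spectrum ?d \<eta>\<^sub>0 \<eta>\<^sub>1 \<xi>) K"
  obtain b where b: "\<And>t. summable (\<lambda>m. b m * t ^ m)" "\<And>u. ?q u = (\<Sum>m. b m * u ^ m)"
    using band_integral_powser [OF continuous_on_bl_spectrum] by blast
  have "isCont (\<lambda>t. \<Sum>m. b m * t ^ m) t" for t
    by (rule DERIV_isCont [OF termdiffs_strong_converges_everywhere]) (rule b)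
  moreover have "?q = (\<lambda>u. \<Sum>m. b m * u ^ m)"
    using b(2) by auto
  ultimately have q: "isCont ?q 0"
    by (simp only:)
  have "((\<lambda>r::real. r\<^sup>2) \<longlongrightarrow> 0\<^sup>2) (at_right 0)"
    by (intro tendsto_intros)
  hence "((\<lambda>r. ?A * ?q (r\<^sup>2)) \<longlongrightarrow> ?A * ?q 0) (at_right 0)"
    by (intro tendsto_mult tendsto_const isCont_tendsto_compose [OF q]) simp
  moreover have "eventually (\<lambda>r. ?A * ?q (r\<^sup>2) = bl_profile ?d \<eta>\<^sub>0 \<eta>\<^sub>1 \<xi> K r) (at_right 0)"
    using eventually_at_right_less [of "0::real"]
    by eventually_elim (simp add: bl_profile_eq [OF d])
  ultimately have "(bl_profile ?d \<eta>\<^sub>0 \<eta>\<^sub>1 \<xi> K \<longlongrightarrow> ?A * ?q 0) (at_right 0)"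
    by (rule Lim_transform_eventually)
  hence "Lim (at_right 0) (bl_profile ?d \<eta>\<^sub>0 \<eta>\<^sub>1 \<xi> K) = ?A * ?q 0"
    by (intro tendsto_Lim) auto
  thus ?thesis
    using True by (simp add: bl_cov_def)
qed

lemma band_integral_bl_spectrum:
  assumes d: "d \<ge> 1" "real d = 2 * \<nu> + 2" and K: "K \<ge> 0" and r: "r > 0"
  shows "band_integral d (bl_spectrum d \<eta>\<^sub>0 \<eta>\<^sub>1 \<xi>) K (r\<^sup>2) =
    1 / (\<eta>\<^sub>0 * \<xi> ^ d) * (K ^ d * bessel_moment 0 \<nu> (K * r) / r ^ (2 * 0))
    + \<eta>\<^sub>1 * \<xi>\<^sup>2 / (\<eta>\<^sub>0 * \<xi> ^ d) * (K ^ d * bessel_moment 1 \<nu> (K * r) / r ^ (2 * 1))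
    + \<xi> ^ 4 / (\<eta>\<^sub>0 * \<xi> ^ d) * (K ^ d * bessel_moment 2 \<nu> (K * r) / r ^ (2 * 2))"
    (is "_ = ?rhs")
proof -
  let ?f = "\<lambda>l s. s ^ (d - 1 + 2 * l) * bessel_clifford \<nu> (s\<^sup>2 * (r\<^sup>2 / 4))"
  have "((\<lambda>s. 1 / (\<eta>\<^sub>0 * \<xi> ^ d) * ?f 0 s + \<eta>\<^sub>1 * \<xi>\<^sup>2 / (\<eta>\<^sub>0 * \<xi> ^ d) * ?f 1 s
      + \<xi> ^ 4 / (\<eta>\<^sub>0 * \<xi> ^ d) * ?f 2 s) has_integral ?rhs) {0..K}"
    by (intro has_integral_add has_integral_mult_right has_integral_bessel_moment d K r)
  moreover have "1 / (\<eta>\<^sub>0 * \<xi> ^ d) * ?f 0 s + \<eta>\<^sub>1 * \<xi>\<^sup>2 / (\<eta>\<^sub>0 * \<xi> ^ d) * ?f 1 s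
      + \<xi> ^ 4 / (\<eta>\<^sub>0 * \<xi> ^ d) * ?f 2 s
      = s ^ (d - 1) * bl_spectrum d \<eta>\<^sub>0 \<eta>\<^sub>1 \<xi> s * bessel_clifford (real d / 2 - 1) (s\<^sup>2 * (r\<^sup>2 / 4))" for s
  proof -
    have "real d / 2 - 1 = \<nu>" using d(2) by linarith
    thus ?thesis
      unfolding bl_spectrum_def by (simp only: power_add) (simp add: algebra_simps power2_eq_square)
  qed
  ultimately show ?thesis
    unfolding band_integral_def by (simp add: integral_unique)
qed

text \<open>The formulas for \<open>S\<^sub>\<mu>\<^sub>,\<^sub>\<nu>\<close> with second index \<open>\<nu>\<close> are the instances of these at \<open>\<nu> + 1\<close>.\<close>
lemma lommel_S_values:
  assumes z: "z > 0"
  shows "lommel_S \<nu> (\<nu> - 1) z = z powr (\<nu> - 1)"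
    and "lommel_S (\<nu> + 2) (\<nu> - 1) z = z powr (\<nu> + 1) * (1 - 4 * \<nu> / z\<^sup>2)"
    and "lommel_S (\<nu> + 4) (\<nu> - 1) z =
           z powr (\<nu> + 3) * (1 - 8 * (1 + \<nu>) / z\<^sup>2 + 32 * \<nu> * (1 + \<nu>) / z ^ 4)"
proof -
  have p: "z powr (\<nu> + 1) = z powr (\<nu> - 1) * z\<^sup>2" "z powr (\<nu> + 3) = z powr (\<nu> - 1) * z ^ 4"
  proof -
    have "z powr (\<nu> + 1) = z powr (\<nu> - 1 + 2)" "z powr (\<nu> + 3) = z powr (\<nu> - 1 + 4)"
      by (simp_all add: add.commute)
    thus "z powr (\<nu> + 1) = z powr (\<nu> - 1) * z\<^sup>2" "z powr (\<nu> + 3) = z powr (\<nu> - 1) * z ^ 4"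
      using z by (simp_all only: powr_add) (simp_all flip: powr_numeral)
  qed
  show "lommel_S \<nu> (\<nu> - 1) z = z powr (\<nu> - 1)"
    using lommel_S_closed_form [OF z, of "\<nu> - 1" 0] by simp
  show "lommel_S (\<nu> + 2) (\<nu> - 1) z = z powr (\<nu> + 1) * (1 - 4 * \<nu> / z\<^sup>2)"
  proof -
    have v: "lommel_S (\<nu> + 2) (\<nu> - 1) z = z powr (\<nu> + 1) - 4 * \<nu> * z powr (\<nu> - 1)"
      using lommel_S_closed_form [OF z, of "\<nu> - 1" 1] by (simp add: add.commute)
    show ?thesis
      unfolding v p using z by (simp add: field_simps)
  qed
  show "lommel_S (\<nu> + 4) (\<nu> - 1) z =
           z powr (\<nu> + 3) * (1 - 8 * (1 + \<nu>) / z\<^sup>2 + 32 * \<nu> * (1 + \<nu>) / z ^ 4)"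
  proof -
    have "lommel_S (\<nu> + 4) (\<nu> - 1) z
        = z powr (\<nu> + 3) - 8 * (\<nu> + 1) * (z powr (\<nu> + 1) - 4 * \<nu> * z powr (\<nu> - 1))"
      using lommel_S_closed_form [OF z, of "\<nu> - 1" 2] by (simp add: numeral_2_eq_2 add.commute)
    moreover have "q * z ^ 4 - 8 * (\<nu> + 1) * (q * z\<^sup>2 - 4 * \<nu> * q)
        = q * z ^ 4 * (1 - 8 * (1 + \<nu>) / z\<^sup>2 + 32 * \<nu> * (1 + \<nu>) / z ^ 4)" for q
      using z by (simp add: field_simps)
    ultimately show ?thesis
      unfolding p by simp
  qed
qed

theorem proposition2:
  fixes \<eta>\<^sub>0 \<eta>\<^sub>1 \<xi> k\<^sub>c \<nu> :: real
    and C :: "real ^ 'n \<Rightarrow> real"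
  assumes "CARD('n) \<ge> 2"
    and "\<nu> = real CARD('n) / 2 - 1"
    and "\<eta>\<^sub>0 > 0" and "\<xi> > 0" and "\<eta>\<^sub>1 > -2" and "k\<^sub>c > 0"
    and "C = bl_cov \<eta>\<^sub>0 \<eta>\<^sub>1 \<xi> k\<^sub>c"
  shows "(\<forall>x z. z = k\<^sub>c * norm x \<and> z > 0 \<longrightarrow>
           C x = (\<Sum>l\<in>{0, 1, 2}. bl_g CARD('n) \<eta>\<^sub>0 \<eta>\<^sub>1 \<xi> k\<^sub>c l / z powr (2 * \<nu> + 2 * real l + 1) *
             ((2 * \<nu> + 2 * real l) * bessel_J \<nu> z * lommel_S (\<nu> + 2 * real l) (\<nu> - 1) z
               - bessel_J (\<nu> - 1) z * lommel_S (\<nu> + 2 * real l + 1) \<nu> z)))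
    \<and> (\<forall>z>0.
         lommel_S \<nu> (\<nu> - 1) z = z powr (\<nu> - 1) \<and>
         lommel_S (\<nu> + 2) (\<nu> - 1) z = z powr (\<nu> + 1) * (1 - 4 * \<nu> / z\<^sup>2) \<and>
         lommel_S (\<nu> + 4) (\<nu> - 1) z =
           z powr (\<nu> + 3) * (1 - 8 * (1 + \<nu>) / z\<^sup>2 + 32 * \<nu> * (1 + \<nu>) / z ^ 4) \<and>
         lommel_S (\<nu> + 1) \<nu> z = z powr \<nu> \<and>
         lommel_S (\<nu> + 3) \<nu> z = z powr (\<nu> + 2) * (1 - 4 * (1 + \<nu>) / z\<^sup>2) \<and>
         lommel_S (\<nu> + 5) \<nu> z =
           z powr (\<nu> + 4) * (1 - 8 * (\<nu> + 2) / z\<^sup>2 + 32 * (\<nu> + 1) * (\<nu> + 2) / z ^ 4))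
    \<and> nonneg_definite C \<and> smooth C \<and> radial C"
proof (intro conjI allI impI)
  let ?d = "CARD('n)"
  let ?p = "bl_spectrum ?d \<eta>\<^sub>0 \<eta>\<^sub>1 \<xi>"
  let ?q = "band_integral ?d ?p k\<^sub>c"
  define A where "A = (2 * pi) powr (- real ?d / 2) * 2 powr (1 - real ?d / 2)"
  have A: "A > 0" by (simp add: A_def)
  have C: "C x = A * ?q ((norm x)\<^sup>2)" for x
    unfolding assms(7) A_def by (rule bl_cov_eq [OF assms(1)])
  have d: "real ?d = 2 * \<nu> + 2" "?d \<ge> 1"
    using assms(1,2) by simp_all
  {
    fix x :: "real ^ 'n" and z :: real
    assume z: "z = k\<^sub>c * norm x \<and> z > 0"
    let ?r = "norm x"
    have r: "?r > 0" and z0: "z > 0"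
      using z assms(6) by (auto simp: zero_less_mult_iff)
    let ?br = "\<lambda>l. (2 * \<nu> + 2 * real l) * bessel_J \<nu> z * lommel_S (\<nu> + 2 * real l) (\<nu> - 1) z
               - bessel_J (\<nu> - 1) z * lommel_S (\<nu> + 2 * real l + 1) \<nu> z"
    \<comment> \<open>The \<open>l\<close>-th summand of the closed form is the contribution of \<open>c\<^sub>l k\<^sup>2\<^sup>l\<close> to the integral.\<close>
    define c where "c = (\<lambda>l::nat. if l = 0 then 1 / (\<eta>\<^sub>0 * \<xi> ^ ?d) else if l = 1
      then \<eta>\<^sub>1 * \<xi>\<^sup>2 / (\<eta>\<^sub>0 * \<xi> ^ ?d) else \<xi> ^ 4 / (\<eta>\<^sub>0 * \<xi> ^ ?d))"
    have summand: "bl_g ?d \<eta>\<^sub>0 \<eta>\<^sub>1 \<xi> k\<^sub>c l / z powr (2 * \<nu> + 2 * real l + 1) * ?br l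
      = A * (c l * (k\<^sub>c ^ ?d * bessel_moment l \<nu> (k\<^sub>c * ?r) / ?r ^ (2 * l)))" if l: "l \<in> {0, 1, 2}" for l
    proof -
      have "lommel_S (\<nu> + 2 * real l) (\<nu> - 1) z = lommel_poly l (\<nu> - 1) z"
        using lommel_S_closed_form [OF z0, of "\<nu> - 1" l] by (simp add: algebra_simps)
      hence br: "z * ?br l = z powr (2 * \<nu> + 2) * 2 powr (- \<nu>) * bessel_moment l \<nu> z"
        using lommel_bracket [OF z0, of \<nu> l] lommel_S_closed_form [OF z0, of \<nu> l] by simp
      have "z powr (2 * \<nu> + 2 * real l + 1) * z = z powr (2 * \<nu> + 2 * real l + 1) * z powr 1"
        using z0 by simp
      also have "\<dots> = z powr (2 * \<nu> + 2 * real l + 1 + 1)"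
        by (rule powr_add [symmetric])
      also have "2 * \<nu> + 2 * real l + 1 + 1 = 2 * \<nu> + 2 + 2 * real l"
        by simp
      also have "z powr (2 * \<nu> + 2 + 2 * real l) = z powr (2 * \<nu> + 2) * z powr (2 * real l)"
        by (rule powr_add)
      also have "z powr (2 * real l) = z ^ (2 * l)"
        using z0 by (simp flip: powr_realpow)
      finally have zp: "z powr (2 * \<nu> + 2 * real l + 1) * z = z powr (2 * \<nu> + 2) * z ^ (2 * l)" .
      have g: "bl_g ?d \<eta>\<^sub>0 \<eta>\<^sub>1 \<xi> k\<^sub>c l = (2 * pi) powr (- real ?d / 2) * c l * k\<^sub>c ^ ?d * k\<^sub>c ^ (2 * l)"
        using l by (auto simp: bl_g_def c_def Let_def powr_minus field_simps power2_eq_square)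
      have zl: "z ^ (2 * l) = k\<^sub>c ^ (2 * l) * ?r ^ (2 * l)"
        using z by (simp add: power_mult_distrib)
      have \<nu>: "- \<nu> = 1 - real ?d / 2"
        using assms(2) by simp
      have "bl_g ?d \<eta>\<^sub>0 \<eta>\<^sub>1 \<xi> k\<^sub>c l / z powr (2 * \<nu> + 2 * real l + 1) * ?br l
        = bl_g ?d \<eta>\<^sub>0 \<eta>\<^sub>1 \<xi> k\<^sub>c l * (z * ?br l) / (z powr (2 * \<nu> + 2 * real l + 1) * z)"
        using z0 by simp
      also have "\<dots> = bl_g ?d \<eta>\<^sub>0 \<eta>\<^sub>1 \<xi> k\<^sub>c l * 2 powr (- \<nu>) * bessel_moment l \<nu> z / z ^ (2 * l)"
        unfolding br zp using z0 by (simp add: field_simps)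
      also have "\<dots> = A * (c l * (k\<^sub>c ^ ?d * bessel_moment l \<nu> (k\<^sub>c * ?r) / ?r ^ (2 * l)))"
        unfolding g zl \<nu> A_def using z assms(6) r by simp
      finally show ?thesis .
    qed
    have "C x = A * (\<Sum>l\<in>{0, 1, 2}. c l * (k\<^sub>c ^ ?d * bessel_moment l \<nu> (k\<^sub>c * ?r) / ?r ^ (2 * l)))"
      unfolding C band_integral_bl_spectrum [OF d(2,1) less_imp_le [OF assms(6)] r]
      by (simp add: c_def)
    also have "\<dots> = (\<Sum>l\<in>{0, 1, 2}. bl_g ?d \<eta>\<^sub>0 \<eta>\<^sub>1 \<xi> k\<^sub>c l / z powr (2 * \<nu> + 2 * real l + 1) * ?br l)"
      unfolding sum_distrib_left by (intro sum.cong refl summand [symmetric])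
    finally show "C x = \<dots>" .
  }
  {
    fix z :: real assume z: "z > 0"
    note v = lommel_S_values [OF z, of \<nu>] lommel_S_values [OF z, of "\<nu> + 1"]
    show "lommel_S \<nu> (\<nu> - 1) z = z powr (\<nu> - 1)" by (rule v)
    show "lommel_S (\<nu> + 2) (\<nu> - 1) z = z powr (\<nu> + 1) * (1 - 4 * \<nu> / z\<^sup>2)" by (rule v)
    show "lommel_S (\<nu> + 4) (\<nu> - 1) z =
           z powr (\<nu> + 3) * (1 - 8 * (1 + \<nu>) / z\<^sup>2 + 32 * \<nu> * (1 + \<nu>) / z ^ 4)" by (rule v)
    have e: "\<nu> + 1 + 2 = \<nu> + 3" "\<nu> + 1 + 4 = \<nu> + 5" "\<nu> + 1 + 1 = \<nu> + 2" "\<nu> + 1 + 3 = \<nu> + 4" "\<nu> + 1 - 1 = \<nu>"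
      "1 + (\<nu> + 1) = \<nu> + 2"
      by simp_all
    show "lommel_S (\<nu> + 1) \<nu> z = z powr \<nu>" using v(4) by simp
    show "lommel_S (\<nu> + 3) \<nu> z = z powr (\<nu> + 2) * (1 - 4 * (1 + \<nu>) / z\<^sup>2)"
      using v(5) unfolding e by (simp add: add.commute)
    show "lommel_S (\<nu> + 5) \<nu> z =
           z powr (\<nu> + 4) * (1 - 8 * (\<nu> + 2) / z\<^sup>2 + 32 * (\<nu> + 1) * (\<nu> + 2) / z ^ 4)"
      using v(6) unfolding e .
  }
  have "nonneg_definite (\<lambda>x::real ^ 'n. ?q ((norm x)\<^sup>2))"
    using nonneg_definite_band_integral [where 'a = "real ^ 'n", of k\<^sub>c ?p]
      continuous_on_bl_spectrum bl_spectrum_nonneg [OF assms(3,4,5)] assms(1) by simp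
  hence "nonneg_definite (\<lambda>x::real ^ 'n. A * ?q ((norm x)\<^sup>2))"
    using A by (auto simp: nonneg_definite_def mult.left_commute [of _ A] simp flip: sum_distrib_left)
  moreover have Cfun: "C = (\<lambda>x. A * ?q ((norm x)\<^sup>2))"
    using C by auto
  ultimately show "nonneg_definite C"
    by simp
  obtain b where b: "\<And>t. summable (\<lambda>m. b m * t ^ m)" "\<And>u. ?q u = (\<Sum>m. b m * u ^ m)"
    using band_integral_powser [OF continuous_on_bl_spectrum] by blast
  have "times_cont_diff n C" for n
    unfolding Cfun b(2) power2_norm_eq_inner
    by (intro times_cont_diff_mult times_cont_diff_const times_cont_diff_powser_inner b(1))
  thus "smooth C"
    by (simp add: smooth_def)
  show "radial C"
    by (simp add: radial_def C)
qed

end
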